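(* Let $q$ be a prime power and $m\geq 1$. Let $M(x)=x^{2m}+c_{2m-1}x^{2m-1}+\cdots+c_1x+1\in\mathbb{F}_q[x]$ be a monic self-reciprocal polynomial of degree $2m$ with $M(0)=1$ (so $c_i=c_{2m-i}$ for all $i$, with $c_0=c_{2m}=1$). Suppose that $x-1$ divides $M(x)$ with multiplicity exactly two, and that $M_1(x)=M(x)/(x-1)^2$ has no factor equal to $x\pm 1$ and all its irreducible factors have multiplicity one. Define \[\Phi(x)=x^{q^{2m}}+c_{2m-1}x^{q^{2m-1}}+\cdots+c_1x^q+x\in\mathbb{F}_q[x],\qquad L(x)=\Phi(x)+tx^{q^m}\in\mathbb{F}_q(t)[x],\] and let $G$ be the Galois group of $L(x)$ over $\mathbb{F}_q(t)$, acting on the $2m$-dimensional $\mathbb{F}_q$-space $V$ of roots of $L$. Then there is a prime ideal of degree $1$ in $\mathbb{F}_q[t]$ whose corresponding Frobenius class in $G$ contains an element a power of which acts on $V$ as a symplectic transvection (with respect to a $G$-invariant nondegenerate alternating bilinear form on $V$).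
   Context: A monic polynomial $g\in\mathbb{F}_q[x]$ of degree $d$ with $g(0)\neq0$ is self-reciprocal if $g(x)=x^dg(0)^{-1}g(x^{-1})$. For a $q$-polynomial $L$ over $\mathbb{F}_q(t)$ with nonzero $x$-coefficient, the roots in a splitting field $E$ form an $\mathbb{F}_q$-vector space $V$ of dimension equal to the $q$-degree, and the Galois group $G$ acts $\mathbb{F}_q$-linearly on $V$. Since $\Phi$ (hence $L$) is $q$-palindromic, there is a nondegenerate alternating bilinear form on $V$ invariant under $G$. Frobenius class: for $\mu\in\mathbb{F}_q$, let $I=(t-\mu)\subset\mathbb{F}_q[t]$ (a prime ideal of degree 1), let $R$ be the integral closure of $\mathbb{F}_q[t]$ in $E$, $J$ a prime of $R$ over $I$, and $D\le G$ the decomposition group of $J$. When the reduction of $L$ mod $I$ has nonzero $x$-coefficient, $D$ is cyclic, generated by an element $\sigma$ with $\sigma(z)\equiv z^q \pmod J$ for all $z\in R$; the $G$-conjugacy class of such $\sigma$ (over all choices of $J$) is the Frobenius class of $I$. A symplectic transvection is an element $\sigma$ of the symplectic group with minimal polynomial $(x-1)^2$ such that $\sigma-I$ has rank one. *)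

theory Defs
  imports "HOL-Computational_Algebra.Computational_Algebra" "HOL-Library.Cardinality"
begin

definition self_reciprocal :: "'a::field poly \<Rightarrow> bool" where
  "self_reciprocal g \<longleftrightarrow> lead_coeff g = 1 \<and> coeff g 0 \<noteq> 0 \<and>
     g = smult (inverse (coeff g 0)) (reflect_poly g)"

definition tvar :: "'a::field poly fract" where
  "tvar = Fract [:0, 1:] 1"

definition const_ff :: "'a::field \<Rightarrow> 'a poly fract" where
  "const_ff c = Fract [:c:] 1"

definition Phi_poly :: "'a::{field,finite} poly \<Rightarrow> 'a poly fract poly" where
  "Phi_poly M = (\<Sum>i\<le>degree M. monom (const_ff (coeff M i)) (CARD('a) ^ i))"

definition L_poly :: "nat \<Rightarrow> 'a::{field,finite} poly \<Rightarrow> 'a poly fract poly" where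
  "L_poly m M = Phi_poly M + monom tvar (CARD('a) ^ m)"

definition field_embedding :: "('k::field \<Rightarrow> 'e::field) \<Rightarrow> bool" where
  "field_embedding f \<longleftrightarrow> inj f \<and> f 0 = 0 \<and> f 1 = 1 \<and>
     (\<forall>x y. f (x + y) = f x + f y) \<and> (\<forall>x y. f (x * y) = f x * f y)"

definition is_subfield :: "'e::field set \<Rightarrow> bool" where
  "is_subfield S \<longleftrightarrow> 0 \<in> S \<and> 1 \<in> S \<and> (\<forall>x\<in>S. \<forall>y\<in>S. x + y \<in> S \<and> x * y \<in> S)
     \<and> (\<forall>x\<in>S. - x \<in> S \<and> inverse x \<in> S)"

definition roots_in :: "('k::field \<Rightarrow> 'e::field) \<Rightarrow> 'k poly \<Rightarrow> 'e set" where
  "roots_in emb p = {x. poly (map_poly emb p) x = 0}"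

definition is_splitting_field :: "('k::field \<Rightarrow> 'e::field) \<Rightarrow> 'k poly \<Rightarrow> bool" where
  "is_splitting_field emb p \<longleftrightarrow> field_embedding emb \<and> p \<noteq> 0 \<and>
     (\<exists>c rs. map_poly emb p = smult c (\<Prod>r\<leftarrow>rs. [:- r, 1:])) \<and>
     (\<forall>S. is_subfield S \<and> range emb \<subseteq> S \<and> roots_in emb p \<subseteq> S \<longrightarrow> S = UNIV)"

definition gal_group :: "('k::field \<Rightarrow> 'e::field) \<Rightarrow> ('e \<Rightarrow> 'e) set" where
  "gal_group emb = {\<sigma>. bij \<sigma> \<and> (\<forall>x y. \<sigma> (x + y) = \<sigma> x + \<sigma> y) \<and>
       (\<forall>x y. \<sigma> (x * y) = \<sigma> x * \<sigma> y) \<and> (\<forall>a. \<sigma> (emb a) = emb a)}"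

definition int_closure :: "('a::field poly fract \<Rightarrow> 'e::field) \<Rightarrow> 'e set" where
  "int_closure emb = {z. \<exists>p :: 'a poly poly. lead_coeff p = 1 \<and>
       poly (map_poly (\<lambda>a. emb (Fract a 1)) p) z = 0}"

definition prime_ideal_in :: "'e::field set \<Rightarrow> 'e set \<Rightarrow> bool" where
  "prime_ideal_in R J \<longleftrightarrow> J \<subseteq> R \<and> J \<noteq> R \<and> 0 \<in> J \<and>
     (\<forall>x\<in>J. \<forall>y\<in>J. x + y \<in> J \<and> - x \<in> J) \<and> (\<forall>r\<in>R. \<forall>x\<in>J. r * x \<in> J) \<and>
     (\<forall>x\<in>R. \<forall>y\<in>R. x * y \<in> J \<longrightarrow> x \<in> J \<or> y \<in> J)"

definition lies_over :: "('a::field poly fract \<Rightarrow> 'e::field) \<Rightarrow> 'e set \<Rightarrow> 'a \<Rightarrow> bool" where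
  "lies_over emb J \<mu> \<longleftrightarrow> {a. emb (Fract a 1) \<in> J} = {a. [:- \<mu>, 1:] dvd a}"

definition frobenius_at ::
  "('a::{field,finite} poly fract \<Rightarrow> 'e::field) \<Rightarrow> 'e set \<Rightarrow> ('e \<Rightarrow> 'e) \<Rightarrow> bool" where
  "frobenius_at emb J \<sigma> \<longleftrightarrow> \<sigma> \<in> gal_group emb \<and> \<sigma> ` J = J \<and>
     (\<forall>z\<in>int_closure emb. \<sigma> z - z ^ CARD('a) \<in> J)"

definition scal :: "('a::field poly fract \<Rightarrow> 'e::field) \<Rightarrow> 'a \<Rightarrow> 'e \<Rightarrow> 'e" where
  "scal emb c x = emb (const_ff c) * x"

definition inv_symplectic_form ::
  "('a::field poly fract \<Rightarrow> 'e::field) \<Rightarrow> 'e set \<Rightarrow> ('e \<Rightarrow> 'e) set \<Rightarrow> ('e \<Rightarrow> 'e \<Rightarrow> 'a) \<Rightarrow> bool" where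
  "inv_symplectic_form emb V G B \<longleftrightarrow>
     (\<forall>x\<in>V. \<forall>y\<in>V. \<forall>z\<in>V. B (x + y) z = B x z + B y z \<and> B z (x + y) = B z x + B z y) \<and>
     (\<forall>c. \<forall>x\<in>V. \<forall>y\<in>V. B (scal emb c x) y = c * B x y \<and> B x (scal emb c y) = c * B x y) \<and>
     (\<forall>x\<in>V. B x x = 0) \<and>
     (\<forall>x\<in>V. (\<forall>y\<in>V. B x y = 0) \<longrightarrow> x = 0) \<and>
     (\<forall>\<sigma>\<in>G. \<forall>x\<in>V. \<forall>y\<in>V. B (\<sigma> x) (\<sigma> y) = B x y)"

text \<open>tau acts on V as a symplectic transvection w.r.t. B: it preserves B,
  its minimal polynomial on V is (x-1)^2, and tau - I has rank one on V.\<close>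
definition symplectic_transvection ::
  "('a::field poly fract \<Rightarrow> 'e::field) \<Rightarrow> 'e set \<Rightarrow> ('e \<Rightarrow> 'e \<Rightarrow> 'a) \<Rightarrow> ('e \<Rightarrow> 'e) \<Rightarrow> bool" where
  "symplectic_transvection emb V B \<tau> \<longleftrightarrow>
     \<tau> ` V = V \<and>
     (\<forall>x\<in>V. \<forall>y\<in>V. B (\<tau> x) (\<tau> y) = B x y) \<and>
     (\<exists>x\<in>V. \<tau> x \<noteq> x) \<and>
     (\<forall>x\<in>V. \<tau> (\<tau> x - x) - (\<tau> x - x) = 0) \<and>
     (\<exists>v\<in>V. v \<noteq> 0 \<and> (\<forall>x\<in>V. \<exists>c. \<tau> x - x = scal emb c v))"

end

theory Submission
  imports Defs "Jordan_Normal_Form.Char_Poly" "HOL-Algebra.Algebraic_Closure_Type"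
begin

hide_const (open) up_ring.monom up_ring.coeff Coset.order Polynomials.degree Polynomials.lead_coeff
  Module.smult

unbundle no m_inv_syntax

text \<open>
  Take the prime \<open>t = 0\<close>. Over an algebraic closure \<open>k\<close> of \<open>F\<^sub>q\<close> the reduction \<open>\<Phi>\<close> of \<open>L\<close> is
  separable, so by Hensel's lemma its roots lift to \<open>k[[t]]\<close> and \<open>E\<close> embeds into \<open>k((t))\<close>. Raising
  coefficients to the \<open>q\<close>-th power restricts to a Frobenius element \<open>\<sigma>\<close> for the prime of integral
  elements with vanishing constant term, and taking constant terms identifies \<open>V\<close> with the roots of
  \<open>\<Phi>\<close>, on which \<open>\<sigma>\<close> is \<open>a \<mapsto> a\<^sup>q\<close>, an operator with annihilator \<open>M\<close>.
  If \<open>e = q\<^sup>n - 1\<close> is a period of the squarefree part \<open>M\<^sub>1\<close>, then \<open>M\<close> divides \<open>(X - 1)(X\<^sup>e - 1)\<close>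
  but not \<open>X\<^sup>e - 1\<close>, because \<open>e\<close> is prime to the characteristic; so \<open>\<sigma>\<^sup>e - 1\<close> is nonzero with
  image in the fixed line \<open>F\<^sub>q\<close>.
  The invariant form is an explicit alternating \<open>q\<close>-bilinear expression \<open>W(x, y)\<close> for which the
  palindromic shape of \<open>L\<close> gives \<open>W\<^sup>q = W\<close> on \<open>V\<close>.
\<close>

section \<open>The Frobenius endomorphism over a finite field\<close>

lemma one_less_card_field: "1 < CARD('a::{field,finite})"
proof -
  have "card {0, 1 :: 'a} \<le> CARD('a)" by (rule card_mono) auto
  then show ?thesis by simp
qed

lemma card_field_power_less_iff: "CARD('a::{field,finite}) ^ i < CARD('a) ^ j \<longleftrightarrow> i < j"
  and card_field_power_le_iff: "CARD('a::{field,finite}) ^ i \<le> CARD('a) ^ j \<longleftrightarrow> i \<le> j"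
  and card_field_power_eq_iff: "CARD('a::{field,finite}) ^ i = CARD('a) ^ j \<longleftrightarrow> i = j"
  using one_less_card_field[where 'a='a] by (auto simp: power_inject_exp)

text \<open>The library proves this for the class \<open>finite_field\<close>, which the sort \<open>{field, finite}\<close> does not entail.\<close>

lemma finite_field_power_card:
  fixes x :: "'a::{field,finite}"
  shows "x ^ CARD('a) = x"
proof (cases "x = 0")
  case False
  have "bij_betw ((*) x) (UNIV - {0}) (UNIV - {0})"
    by (rule bij_betwI[of _ _ _ "\<lambda>y. y / x"]) (use False in auto)
  then have "(\<Prod>y\<in>UNIV - {0}. x * y) = \<Prod>(UNIV - {0})"
    by (rule prod.reindex_bij_betw)
  then have "x ^ (CARD('a) - 1) * \<Prod>(UNIV - {0}) = \<Prod>(UNIV - {0})"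
    by (simp add: prod.distrib card_Diff_singleton)
  moreover have "\<Prod>(UNIV - {0::'a}) \<noteq> 0" by simp
  ultimately have "x ^ (CARD('a) - 1) = 1" by simp
  then show ?thesis by (simp add: power_eq_if)
qed (simp add: zero_power)

text \<open>The polynomial \<open>(X + 1)\<^sup>q - X\<^sup>q - 1\<close> has degree below \<open>q\<close> but vanishes on all \<open>q\<close> elements.\<close>

lemma of_nat_card_field_choose_eq_0:
  assumes "0 < i" "i < CARD('a::{field,finite})"
  shows "of_nat (CARD('a) choose i) = (0::'a)"
proof -
  let ?q = "CARD('a)"
  define p where "p = (\<Sum>j\<in>{0<..<?q}. monom (of_nat (?q choose j)) j :: 'a poly)"
  have card_gt_1: "1 < ?q" by (rule one_less_card_field)
  have "degree p \<le> ?q - 1" unfolding p_def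
    by (rule degree_sum_le) (auto intro: order.trans[OF degree_monom_le])
  moreover have "poly p x = 0" for x
  proof -
    have "(x + 1) ^ ?q = (\<Sum>j\<le>?q. of_nat (?q choose j) * x ^ j)"
      by (simp add: binomial_ring)
    also have "{..?q} = insert 0 (insert ?q {0<..<?q})" using card_gt_1 by auto
    also have "(\<Sum>j\<in>\<dots>. of_nat (?q choose j) * x ^ j) = 1 + (x ^ ?q + poly p x)"
      using card_gt_1 by (simp add: p_def poly_sum poly_monom)
    finally show ?thesis by (simp add: finite_field_power_card)
  qed
  ultimately have "p = 0" using card_gt_1
    by (intro poly_eqI_degree[of UNIV]) auto
  then have "coeff p i = 0" by simp
  then show ?thesis using assms by (simp add: p_def coeff_sum if_distrib sum.delta cong: if_cong)
qed

lemma of_nat_card_field_eq_0: "of_nat CARD('a) = (0::'a::{field,finite})"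
  using of_nat_card_field_choose_eq_0[where 'a='a, of 1] one_less_card_field[where 'a='a] by simp

locale fq_algebra = comm_ring_hom h for h :: "'a::{field,finite} \<Rightarrow> 'b::comm_ring_1"
begin

lemma add_power_card: "(x + y :: 'b) ^ CARD('a) = x ^ CARD('a) + y ^ CARD('a)"
proof -
  let ?q = "CARD('a)"
  have card_gt_1: "1 < ?q" by (rule one_less_card_field)
  have choose: "of_nat (?q choose j) = (0::'b)" if "j \<in> {0<..<?q}" for j
    using of_nat_card_field_choose_eq_0[where 'a='a, of j] that
    by (metis greaterThanLessThan_iff hom_of_nat hom_zero)
  have "(x + y) ^ ?q = (\<Sum>j\<le>?q. of_nat (?q choose j) * x ^ j * y ^ (?q - j))"
    by (rule binomial_ring)
  also have "{..?q} = insert 0 (insert ?q {0<..<?q})" using card_gt_1 by auto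
  also have "(\<Sum>j\<in>\<dots>. of_nat (?q choose j) * x ^ j * y ^ (?q - j)) = x ^ ?q + y ^ ?q"
    using card_gt_1 choose by simp
  finally show ?thesis .
qed

sublocale frob: comm_ring_hom "\<lambda>x :: 'b. x ^ CARD('a)"
  by unfold_locales (simp_all add: zero_power add_power_card power_mult_distrib)

sublocale frob_pow: comm_ring_hom "\<lambda>x :: 'b. x ^ (CARD('a) ^ i)" for i
proof
  show "(x + y :: 'b) ^ (CARD('a) ^ i) = x ^ (CARD('a) ^ i) + y ^ (CARD('a) ^ i)" for x y
    by (induction i) (simp_all add: power_mult frob.hom_add mult.commute[of "CARD('a)"])
qed (simp_all add: zero_power power_mult_distrib)

lemma hom_power_card: "h c ^ CARD('a) = h c"
  by (simp add: finite_field_power_card flip: hom_power)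

lemma hom_power_card_power: "h c ^ (CARD('a) ^ i) = h c"
  by (induction i) (simp_all add: power_mult hom_power_card)

lemma of_nat_card_eq_0: "of_nat CARD('a) = (0::'b)"
  using of_nat_card_field_eq_0[where 'a='a] by (metis hom_of_nat hom_zero)

end

locale fq_hom = field_hom h for h :: "'a::{field,finite} \<Rightarrow> 'b::field"
begin

sublocale fq_algebra h by unfold_locales

lemma power_card_eq_imp_in_range:
  assumes "x ^ CARD('a) = x"
  shows "x \<in> range h"
proof (rule ccontr)
  assume x_notin: "x \<notin> range h"
  have card_gt_1: "1 < CARD('a)" by (rule one_less_card_field)
  have card: "card (insert x (range h)) = Suc CARD('a)"
    using x_notin by (simp add: card_image inj_on_def)
  have "monom (1::'b) CARD('a) = monom 1 1"
  proof (rule poly_eqI_degree)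
    show "poly (monom 1 CARD('a)) y = poly (monom 1 1) y" if "y \<in> insert x (range h)" for y
      using that assms by (auto simp: poly_monom hom_power_card)
  qed (use card_gt_1 card in \<open>simp_all add: degree_monom_eq\<close>)
  then have "degree (monom (1::'b) CARD('a)) = degree (monom (1::'b) 1)" by simp
  then show False using card_gt_1 by (simp add: degree_monom_eq)
qed

end

section \<open>Linearized polynomials\<close>

definition q_associate :: "('a::{field,finite} \<Rightarrow> 'b::comm_ring_1) \<Rightarrow> 'a poly \<Rightarrow> 'b poly" where
  "q_associate h P = (\<Sum>i\<le>degree P. monom (h (coeff P i)) (CARD('a) ^ i))"

definition deformed_associate ::
  "('a::{field,finite} \<Rightarrow> 'b::comm_ring_1) \<Rightarrow> 'b \<Rightarrow> nat \<Rightarrow> 'a poly \<Rightarrow> 'b poly" where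
  "deformed_associate h \<tau> m P = q_associate h P + monom \<tau> (CARD('a) ^ m)"

lemma L_poly_eq_deformed_associate: "L_poly m M = deformed_associate const_ff tvar m M"
  by (simp add: L_poly_def Phi_poly_def deformed_associate_def q_associate_def)

lemma (in comm_ring_hom) map_poly_deformed_associate:
  "map_poly hom (deformed_associate h \<tau> m P) = deformed_associate (\<lambda>c. hom (h c)) (hom \<tau>) m P"
proof -
  interpret map_hom: map_poly_comm_ring_hom hom ..
  show ?thesis
    by (simp add: deformed_associate_def q_associate_def map_hom.hom_add map_hom.hom_sum)
qed

lemma degree_q_associate_le:
  fixes P :: "'a::{field,finite} poly"
  shows "degree (q_associate h P) \<le> CARD('a) ^ degree P"
  unfolding q_associate_def
  by (rule degree_sum_le) (auto intro!: order.trans[OF degree_monom_le] simp: card_field_power_le_iff)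

lemma degree_deformed_associate_le:
  fixes P :: "'a::{field,finite} poly"
  assumes "m \<le> degree P"
  shows "degree (deformed_associate h \<tau> m P) \<le> CARD('a) ^ degree P"
  unfolding deformed_associate_def
  by (rule degree_add_le[OF degree_q_associate_le order.trans[OF degree_monom_le]])
     (simp add: card_field_power_le_iff assms)

context fq_algebra
begin

lemma q_associate_eq_sum:
  "degree P \<le> n \<Longrightarrow> q_associate h P = (\<Sum>i\<le>n. monom (h (coeff P i)) (CARD('a) ^ i))"
  unfolding q_associate_def by (rule sum.mono_neutral_left) (auto simp: coeff_eq_0)

lemma poly_q_associate: "poly (q_associate h P) x = (\<Sum>i\<le>degree P. h (coeff P i) * x ^ (CARD('a) ^ i))"
  by (simp add: q_associate_def poly_sum poly_monom)

lemma coeff_q_associate: "coeff (q_associate h P) (CARD('a) ^ k) = h (coeff P k)"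
proof -
  have "q_associate h P = (\<Sum>i\<le>max k (degree P). monom (h (coeff P i)) (CARD('a) ^ i))"
    by (rule q_associate_eq_sum) simp
  then have "coeff (q_associate h P) (CARD('a) ^ k) =
      (\<Sum>i\<le>max k (degree P). if i = k then h (coeff P i) else 0)"
    by (simp add: coeff_sum card_field_power_eq_iff)
  then show ?thesis by simp
qed

lemma q_associate_0 [simp]: "q_associate h 0 = 0"
  by (simp add: q_associate_def)

lemma q_associate_1: "q_associate h 1 = [:0, 1:]"
  by (simp add: q_associate_def monom_Suc monom_0)

lemma q_associate_add: "q_associate h (P + Q) = q_associate h P + q_associate h Q"
proof -
  let ?n = "max (degree P) (degree Q)"
  have "degree (P + Q) \<le> ?n" by (rule degree_add_le_max)
  then show ?thesis
    by (simp add: q_associate_eq_sum[of _ ?n] hom_add add_monom[symmetric] sum.distrib)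
qed

lemma q_associate_diff: "q_associate h (P - Q) = q_associate h P - q_associate h Q"
  using q_associate_add[of "P - Q" Q] by (simp add: algebra_simps)

lemma q_associate_smult: "q_associate h (smult c P) = smult (h c) (q_associate h P)"
  by (simp add: q_associate_eq_sum[of _ "degree P"] degree_smult_le hom_mult smult_monom[symmetric]
      smult_sum2)

lemma poly_q_associate_pCons:
  "poly (q_associate h (pCons a P)) x = h a * x + poly (q_associate h P) x ^ CARD('a)"
proof -
  have "q_associate h (pCons a P) = (\<Sum>i\<le>Suc (degree P). monom (h (coeff (pCons a P) i)) (CARD('a) ^ i))"
    by (rule q_associate_eq_sum) (simp add: degree_pCons_le)
  then have "poly (q_associate h (pCons a P)) x =
      h a * x + (\<Sum>i\<le>degree P. h (coeff P i) * x ^ (CARD('a) ^ i * CARD('a)))"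
    by (simp add: poly_sum poly_monom sum.atMost_Suc_shift mult.commute[of "CARD('a)"] del: sum.atMost_Suc)
  also have "(\<Sum>i\<le>degree P. h (coeff P i) * x ^ (CARD('a) ^ i * CARD('a))) = poly (q_associate h P) x ^ CARD('a)"
    by (simp add: poly_q_associate frob.hom_sum power_mult power_mult_distrib hom_power_card)
  finally show ?thesis .
qed

lemma poly_q_associate_mult:
  "poly (q_associate h (P * Q)) x = poly (q_associate h P) (poly (q_associate h Q) x)"
  by (induction P)
     (simp_all add: q_associate_add q_associate_smult poly_q_associate_pCons)

lemma poly_q_associate_X_power_minus_1:
  "poly (q_associate h (monom 1 k - 1)) x = x ^ (CARD('a) ^ k) - x"
proof -
  have "poly (q_associate h (monom 1 k)) x = x ^ (CARD('a) ^ k)"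
    by (induction k)
       (simp_all add: monom_0 monom_Suc poly_q_associate_pCons power_mult mult.commute[of "CARD('a)"])
  then show ?thesis by (simp add: q_associate_diff q_associate_1)
qed

lemma poly_q_associate_0 [simp]: "poly (q_associate h P) 0 = 0"
  by (simp add: poly_q_associate)

lemma poly_q_associate_at_1: "poly (q_associate h P) 1 = h (poly P 1)"
  by (simp add: poly_q_associate poly_altdef[of P] hom_sum)

lemma poly_q_associate_eq_0_if_dvd:
  "Q dvd P \<Longrightarrow> poly (q_associate h Q) x = 0 \<Longrightarrow> poly (q_associate h P) x = 0"
  by (auto simp: mult.commute[of Q] poly_q_associate_mult elim!: dvdE)

lemma poly_deformed_associate_add:
  "poly (deformed_associate h \<tau> m P) (x + y) =
   poly (deformed_associate h \<tau> m P) x + poly (deformed_associate h \<tau> m P) y"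
  by (simp add: deformed_associate_def poly_q_associate poly_monom frob_pow.hom_add algebra_simps sum.distrib)

lemma poly_deformed_associate_scale:
  "poly (deformed_associate h \<tau> m P) (h c * x) = h c * poly (deformed_associate h \<tau> m P) x"
  by (simp add: deformed_associate_def poly_q_associate poly_monom power_mult_distrib hom_power_card_power
      sum_distrib_left algebra_simps)

end

context fq_hom
begin

lemma degree_q_associate: "P \<noteq> 0 \<Longrightarrow> degree (q_associate h P) = CARD('a) ^ degree P"
  using degree_q_associate_le[of h P]
  by (intro antisym le_degree) (simp_all add: coeff_q_associate)

lemma pderiv_q_associate: "pderiv (q_associate h P) = [:h (coeff P 0):]"
proof -
  have "pderiv (q_associate h P) = (\<Sum>i\<le>degree P. if i = 0 then [:h (coeff P 0):] else 0)"
    unfolding q_associate_def pderiv_sum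
    by (rule sum.cong) (auto simp: pderiv_monom of_nat_card_eq_0 zero_power monom_0)
  then show ?thesis by simp
qed

lemma q_associate_vanishing_imp_eq_0:
  assumes "\<And>y. y \<in> A \<Longrightarrow> poly (q_associate h P) y = 0" "CARD('a) ^ degree P < card A"
  shows "P = 0"
proof -
  have "q_associate h P = 0"
    by (rule poly_eqI_degree[of A]) (use assms degree_q_associate_le[of h P] in auto)
  then have "h (coeff P k) = 0" for k using coeff_q_associate[of P k] by simp
  then show ?thesis by (intro poly_eqI) simp
qed

end

section \<open>Periods of squarefree polynomials over finite fields\<close>

lemma bezout_in_subring:
  fixes A :: "'a::euclidean_ring set"
  assumes "0 \<in> A" "1 \<in> A" and diff: "\<And>x y. x \<in> A \<Longrightarrow> y \<in> A \<Longrightarrow> x - y \<in> A"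
    and mult: "\<And>x y. x \<in> A \<Longrightarrow> y \<in> A \<Longrightarrow> x * y \<in> A"
    and div: "\<And>x y. x \<in> A \<Longrightarrow> y \<in> A \<Longrightarrow> x div y \<in> A"
    and "a \<in> A" "b \<in> A"
  shows "\<exists>u\<in>A. \<exists>v\<in>A. u * a + v * b dvd a \<and> u * a + v * b dvd b"
  using assms(6,7)
proof (induction "euclidean_size b" arbitrary: a b rule: less_induct)
  case less
  show ?case
  proof (cases "b = 0")
    case True
    then show ?thesis using assms(1,2) by (intro bexI[of _ 1] bexI[of _ 0]) auto
  next
    case False
    have "a mod b = a - a div b * b" by (simp add: minus_div_mult_eq_mod)
    then have "a mod b \<in> A" using less.prems diff mult div by simp
    then obtain u v where uv_in: "u \<in> A" "v \<in> A" and
      dvd: "u * b + v * (a mod b) dvd b" "u * b + v * (a mod b) dvd a mod b"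
      using less.hyps[of "a mod b" b] mod_size_less[OF False] less.prems(2) by blast
    have "u * b + v * (a mod b) = v * a + (u - v * (a div b)) * b"
      by (simp add: \<open>a mod b = a - a div b * b\<close> algebra_simps)
    moreover have "u * b + v * (a mod b) dvd a" using dvd by (simp add: dvd_mod_iff)
    ultimately show ?thesis
      using uv_in dvd(1) less.prems diff mult div by (intro bexI[of _ v] bexI[of _ "u - v * (a div b)"]) simp_all
  qed
qed

text \<open>With \<open>d = gcd(a, b)\<close> and \<open>a = d e\<close>, \<open>b = d b'\<close>, the hypothesis
  makes \<open>e\<close>, which is prime to \<open>b'\<close>, divide \<open>d\<close>.\<close>

lemma squarefree_dvd_square_imp_dvd:
  fixes a b :: "'a::euclidean_ring"
  assumes "squarefree a" "a dvd b ^ 2"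
  shows "a dvd b"
proof (cases "a = 0")
  case False
  obtain u v where dvd: "u * a + v * b dvd a" "u * a + v * b dvd b"
    using bezout_in_subring[of UNIV a b] by auto
  define d where "d = u * a + v * b"
  obtain e b' where a_eq: "a = d * e" and b_eq: "b = d * b'"
    using dvd unfolding d_def by (auto elim!: dvdE)
  have "d \<noteq> 0" using False a_eq by auto
  have "d * (u * e + v * b') = u * a + v * b" unfolding a_eq b_eq by (simp add: algebra_simps)
  then have "d * (u * e + v * b') = d * 1" by (simp add: d_def)
  then have bezout: "u * e + v * b' = 1" using \<open>d \<noteq> 0\<close> mult_left_cancel by blast
  have "d * e dvd d * (d * b' ^ 2)"
    using assms(2) unfolding a_eq b_eq by (simp add: power2_eq_square ac_simps)
  then have "e dvd d * b' ^ 2" using \<open>d \<noteq> 0\<close> by simp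
  then have "e dvd e * (d * u * (u * e + 2 * v * b')) + v ^ 2 * (d * b' ^ 2)" by simp
  also have "\<dots> = d * (u * e + v * b') ^ 2" by (simp add: algebra_simps power2_eq_square)
  also have "\<dots> = d" by (simp add: bezout)
  finally have "e ^ 2 dvd a" by (simp add: a_eq power2_eq_square mult_dvd_mono)
  then have "e dvd 1" using assms(1) by (simp add: squarefree_def)
  then have "a dvd d" using mult_dvd_mono[of d d e 1] a_eq by simp
  also have "d dvd b" by (simp add: b_eq)
  finally show ?thesis .
qed (use assms in simp)

lemma squarefree_dvd_power_imp_dvd:
  fixes a b :: "'a::euclidean_ring"
  assumes "squarefree a" "a dvd b ^ n"
  shows "a dvd b"
proof -
  have "a dvd b ^ (2 ^ k) \<Longrightarrow> a dvd b" for k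
    by (induction k) (auto simp: power_mult mult.commute[of 2] dest: squarefree_dvd_square_imp_dvd[OF assms(1)])
  moreover have "a dvd b ^ (2 ^ n)"
    using assms(2) by (rule dvd_trans) (simp add: le_imp_power_dvd less_imp_le)
  ultimately show ?thesis by blast
qed

lemma dvd_linear_mult_imp_dvd:
  fixes p :: "'a::idom poly"
  assumes "p dvd [:- r, 1:] * c" "poly p r \<noteq> 0"
  shows "p dvd c"
proof -
  obtain e where mult_eq: "[:- r, 1:] * c = p * e" using assms(1) by (rule dvdE)
  have "poly (p * e) r = 0" unfolding mult_eq[symmetric] by simp
  then obtain f where "e = [:- r, 1:] * f"
    using assms(2) by (auto simp: poly_eq_0_iff_dvd elim: dvdE)
  then have "[:- r, 1:] * c = [:- r, 1:] * (p * f)" using mult_eq by (simp only: mult_ac)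
  then have "c = p * f" by (subst (asm) mult_left_cancel) simp_all
  then show ?thesis by simp
qed

lemma poly_pderiv_linear_mult:
  fixes r :: "'a::idom poly"
  shows "poly (pderiv ([:- a, 1:] * r)) a = poly r a"
proof -
  have "pderiv ([:- a, 1:] * r) = [:- a, 1:] * pderiv r + r * pderiv [:- a, 1:]"
    by (rule pderiv_mult)
  moreover have "pderiv [:- a, 1:] = 1" by (simp add: pderiv_pCons one_pCons)
  ultimately show ?thesis by (simp only: poly_add poly_mult) simp
qed

lemma poly_pderiv_eq_0_if_square_dvd:
  fixes p :: "'a::idom poly"
  assumes "[:- a, 1:] ^ 2 dvd p"
  shows "poly (pderiv p) a = 0"
proof -
  obtain u where "p = [:- a, 1:] ^ 2 * u" using assms by (rule dvdE)
  then have "p = [:- a, 1:] * ([:- a, 1:] * u)" by (simp only: power2_eq_square mult.assoc)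
  then have "poly (pderiv p) a = poly ([:- a, 1:] * u) a" by (simp only: poly_pderiv_linear_mult)
  then show ?thesis by simp
qed

lemma finite_polys_degree_le: "finite {p :: 'a::{zero,finite} poly. degree p \<le> n}"
proof (rule finite_imageD)
  have "coeffs ` {p :: 'a poly. degree p \<le> n} \<subseteq> {xs. set xs \<subseteq> UNIV \<and> length xs \<le> Suc n}"
    by (auto simp: coeffs_def)
  then show "finite (coeffs ` {p :: 'a poly. degree p \<le> n})"
    by (rule finite_subset) (rule finite_lists_length_le, simp)
  show "inj_on coeffs {p :: 'a poly. degree p \<le> n}" by (simp add: inj_on_def coeffs_eq_iff)
qed

text \<open>The powers \<open>X ^ (q ^ i)\<close> repeat modulo \<open>p\<close>, and a difference of two of them is a \<open>q ^ i\<close>-th power.\<close>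

lemma squarefree_poly_period:
  fixes p :: "'a::{field,finite} poly"
  assumes "squarefree p" "coeff p 0 \<noteq> 0"
  shows "\<exists>n>0. p dvd monom 1 (CARD('a) ^ n - 1) - 1"
proof -
  interpret fq_algebra "\<lambda>c::'a. [:c:]" by standard auto
  let ?q = "CARD('a)"
  define f where "f i = monom (1::'a) (?q ^ i) mod p" for i
  have "p \<noteq> 0" using assms(2) by auto
  then have "degree (f i) \<le> degree p" for i
    using degree_mod_less[of p "monom 1 (?q ^ i)"] by (auto simp: f_def)
  then have "finite (range f)"
    by (intro finite_subset[OF _ finite_polys_degree_le[of "degree p"]]) auto
  then have "\<not> inj f" using infinite_UNIV_nat by (auto dest: finite_imageD)
  then obtain i j where repetition: "i < j" "f i = f j" by (metis injI linorder_neqE_nat)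
  define n where "n = j - i"
  have j_eq: "j = n + i" "n > 0" using repetition by (auto simp: n_def)
  define b where "b = monom (1::'a) (?q ^ n) - monom 1 1"
  have "p dvd monom 1 (?q ^ j) - monom 1 (?q ^ i)"
    using repetition(2)[symmetric] by (simp add: f_def mod_eq_dvd_iff)
  also have "monom 1 (?q ^ j) - monom 1 (?q ^ i) = b ^ (?q ^ i)"
    by (simp add: b_def frob_pow.hom_minus monom_power j_eq power_add)
  finally have "p dvd b" using assms(1) squarefree_dvd_power_imp_dvd by blast
  also have "b = [:- 0, 1:] * (monom 1 (?q ^ n - 1) - 1)"
  proof -
    have "monom (1::'a) (?q ^ n) = [:0, 1:] * monom 1 (?q ^ n - 1)"
      using monom_Suc[of "1::'a" "?q ^ n - 1"] by simp
    moreover have "monom (1::'a) 1 = [:0, 1:]" by (simp add: monom_altdef)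
    ultimately show ?thesis by (simp add: b_def right_diff_distrib)
  qed
  finally have "p dvd monom 1 (?q ^ n - 1) - 1"
    by (rule dvd_linear_mult_imp_dvd) (use assms(2) in \<open>simp add: poly_0_coeff_0\<close>)
  then show ?thesis using j_eq(2) by blast
qed

lemma linear_square_not_dvd_X_power_minus_1:
  assumes "(of_nat e :: 'a::idom) \<noteq> 0"
  shows "\<not> [:-1, 1:] ^ 2 dvd (monom 1 e - 1 :: 'a poly)"
proof
  assume "[:-1, 1:] ^ 2 dvd (monom 1 e - 1 :: 'a poly)"
  then have "poly (pderiv (monom 1 e - 1)) (1 :: 'a) = 0" by (rule poly_pderiv_eq_0_if_square_dvd)
  then show False using assms by (simp add: pderiv_diff pderiv_monom poly_monom)
qed

lemma ex_transvection_exponent: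
  fixes M :: "'a::{field,finite} poly"
  assumes "coeff M 0 \<noteq> 0" "order 1 M = 2" "squarefree (M div [:-1, 1:] ^ 2)"
  shows "\<exists>e. M dvd [:-1, 1:] * (monom 1 e - 1) \<and> \<not> M dvd monom 1 e - 1"
proof -
  have "M \<noteq> 0" using assms(1) by auto
  then obtain M1 where "M = [:-1, 1:] ^ order 1 M * M1" and "\<not> [:-1, 1:] dvd M1"
    using order_decomp by blast
  then have M_eq: "M = [:-1, 1:] ^ 2 * M1" and M1_at_1: "poly M1 1 \<noteq> 0"
    unfolding assms(2) poly_eq_0_iff_dvd .
  have div_eq: "M div [:-1, 1:] ^ 2 = M1"
    unfolding M_eq by (rule nonzero_mult_div_cancel_left) simp
  have "coeff M1 0 \<noteq> 0"
    using assms(1) unfolding M_eq poly_0_coeff_0[symmetric] poly_mult by simp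
  then obtain n where n_pos: "0 < n" and period: "M1 dvd monom 1 (CARD('a) ^ n - 1) - 1"
    using squarefree_poly_period assms(3) unfolding div_eq by blast
  define e where "e = CARD('a) ^ n - 1"
  define F where "F = monom (1::'a) e - 1"
  have "poly F 1 = 0" by (simp add: F_def poly_monom)
  then obtain H where F_eq: "F = [:-1, 1:] * H" unfolding poly_eq_0_iff_dvd by (rule dvdE)
  have "M1 dvd H"
    using period M1_at_1 by (fold e_def F_def, unfold F_eq) (rule dvd_linear_mult_imp_dvd)
  then have "M dvd [:-1, 1:] ^ 2 * H" unfolding M_eq by (intro mult_dvd_mono dvd_refl)
  then have "M dvd [:-1, 1:] * F" by (simp only: F_eq power2_eq_square mult.assoc)
  moreover have "of_nat e = (-1::'a)"
    using n_pos by (simp add: e_def of_nat_diff of_nat_card_field_eq_0 zero_power)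
  then have "\<not> [:-1, 1:] ^ 2 dvd F"
    unfolding F_def by (intro linear_square_not_dvd_X_power_minus_1) simp
  then have "\<not> M dvd F" unfolding M_eq by (blast dest: dvd_mult_left)
  ultimately show ?thesis unfolding F_def by blast
qed

section \<open>Simple roots over algebraically closed fields\<close>

lemma size_proots_alg_closed: "size (proots p) = degree p" for p :: "'k::alg_closed_field poly"
proof (cases "p = 0")
  case False
  then obtain A where factors: "size A = degree p" "p = smult (lead_coeff p) (\<Prod>x\<in>#A. [:- x, 1:])"
    using alg_closed_imp_factorization by blast
  have "proots p = proots (\<Prod>x\<in>#A. [:- x, 1:])"
    using False by (subst factors(2)) simp
  also have "\<dots> = A"
    by (induction A) (simp_all add: proots_mult prod_mset_zero_iff image_iff del: mult_pCons_left)
  finally show ?thesis using factors(1) by simp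
qed simp

lemma rsquarefree_iff_pderiv:
  fixes p :: "'a::idom poly"
  shows "rsquarefree p \<longleftrightarrow> p \<noteq> 0 \<and> (\<forall>x. poly p x = 0 \<longrightarrow> poly (pderiv p) x \<noteq> 0)"
proof (cases "p = 0")
  case False
  have "order x p = 1 \<longleftrightarrow> poly (pderiv p) x \<noteq> 0" if root: "poly p x = 0" for x
  proof
    assume "order x p = 1"
    then obtain r where r: "p = [:- x, 1:] * r" "\<not> [:- x, 1:] dvd r"
      using order_decomp[OF False, of x] by auto
    then show "poly (pderiv p) x \<noteq> 0"
      unfolding r(1) poly_pderiv_linear_mult poly_eq_0_iff_dvd by simp
  next
    assume "poly (pderiv p) x \<noteq> 0"
    then have "order x p < 2"
      using poly_pderiv_eq_0_if_square_dvd[of x p] order_divides[of x 2 p] by auto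
    moreover have "order x p \<noteq> 0" using root False order_root by blast
    ultimately show "order x p = 1" by linarith
  qed
  then show ?thesis unfolding rsquarefree_def using False order_root[of p] by blast
qed (simp add: rsquarefree_def)

lemma card_roots_rsquarefree:
  fixes p :: "'k::alg_closed_field poly"
  assumes "rsquarefree p"
  shows "card {x. poly p x = 0} = degree p"
proof -
  have "p \<noteq> 0" using assms by (simp add: rsquarefree_def)
  then have "size (proots p) = card {x. poly p x = 0}"
    using rsquarefree_root_order[OF assms] by (simp add: size_multiset_overloaded_eq)
  then show ?thesis by (simp add: size_proots_alg_closed)
qed

locale fq_alg_closed = fq_hom h for h :: "'a::{field,finite} \<Rightarrow> 'k::alg_closed_field"
begin

lemma rsquarefree_q_associate: "coeff P 0 \<noteq> 0 \<Longrightarrow> rsquarefree (q_associate h P)"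
  unfolding rsquarefree_iff_pderiv pderiv_q_associate
  using coeff_q_associate[of P 0] by auto

lemma card_roots_q_associate:
  assumes "coeff P 0 \<noteq> 0"
  shows "card {x. poly (q_associate h P) x = 0} = CARD('a) ^ degree P"
proof -
  have "P \<noteq> 0" using assms by auto
  then show ?thesis
    using card_roots_rsquarefree[OF rsquarefree_q_associate[OF assms]] by (simp add: degree_q_associate)
qed

lemma q_associate_roots_subset_iff_dvd:
  assumes "coeff P 0 \<noteq> 0"
  shows "(\<forall>x. poly (q_associate h P) x = 0 \<longrightarrow> poly (q_associate h Q) x = 0) \<longleftrightarrow> P dvd Q"
proof
  assume vanish: "\<forall>x. poly (q_associate h P) x = 0 \<longrightarrow> poly (q_associate h Q) x = 0"
  have "Q mod P = 0"
  proof (rule ccontr)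
    assume mod_nonzero: "Q mod P \<noteq> 0"
    have "P \<noteq> 0" using assms by auto
    then have "degree (Q mod P) < degree P" using mod_nonzero degree_mod_less by blast
    moreover have "poly (q_associate h (Q mod P)) x = 0" if "poly (q_associate h P) x = 0" for x
    proof -
      have "Q mod P = Q - Q div P * P" by (simp add: minus_div_mult_eq_mod)
      then show ?thesis using vanish that by (simp add: q_associate_diff poly_q_associate_mult)
    qed
    ultimately have "Q mod P = 0"
      by (intro q_associate_vanishing_imp_eq_0[of "{x. poly (q_associate h P) x = 0}"])
         (simp_all add: card_roots_q_associate[OF assms] card_field_power_less_iff)
    then show False using mod_nonzero by contradiction
  qed
  then show "P dvd Q" by (simp add: mod_eq_0_iff_dvd)
qed (use poly_q_associate_eq_0_if_dvd in blast)

end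

section \<open>Integral elements\<close>

definition integral_over :: "('r::comm_ring_1 \<Rightarrow> 'e::comm_ring_1) \<Rightarrow> 'e \<Rightarrow> bool" where
  "integral_over h z \<longleftrightarrow> (\<exists>p. lead_coeff p = 1 \<and> poly (map_poly h p) z = 0)"

locale field_algebra = comm_ring_hom h for h :: "'r::comm_ring_1 \<Rightarrow> 'e::field"
begin

sublocale base: Modules.module "\<lambda>a x. h a * x"
  by unfold_locales (simp_all add: hom_add hom_mult algebra_simps)

lemma integral_over_if_eigenvalue:
  assumes A_carrier: "A \<in> carrier_mat n n" and "eigenvalue (map_mat h A) z"
  shows "integral_over h z"
proof -
  have "poly (char_poly (map_mat h A)) z = 0"
    using assms by (simp add: eigenvalue_root_char_poly[of _ n])
  then have "poly (map_poly h (char_poly A)) z = 0"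
    by (simp add: char_poly_hom[OF A_carrier])
  then show ?thesis
    unfolding integral_over_def using degree_monic_char_poly[OF A_carrier] by blast
qed

text \<open>The determinant trick: \<open>z\<close> is an eigenvalue of its matrix on the generators \<open>W\<close>.\<close>

lemma integral_over_if_stable:
  assumes "finite W" "1 \<in> W" and stable: "\<And>w. w \<in> W \<Longrightarrow> z * w \<in> base.span W"
  shows "integral_over h z"
proof -
  have "\<exists>c. \<forall>w\<in>W. z * w = (\<Sum>u\<in>W. h (c w u) * u)"
    using stable unfolding base.span_finite[OF assms(1)] by (intro bchoice) blast
  then obtain c where mult_eq_sum: "\<And>w. w \<in> W \<Longrightarrow> z * w = (\<Sum>u\<in>W. h (c w u) * u)" by blast
  define n where "n = card W"
  obtain e where e_bij: "bij_betw e {0..<n} W"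
    unfolding n_def using ex_bij_betw_nat_finite[OF assms(1)] by blast
  define A where "A = mat n n (\<lambda>(i, j). c (e i) (e j))"
  define v where "v = vec n e"
  have "v \<noteq> 0\<^sub>v n"
  proof
    assume v_zero: "v = 0\<^sub>v n"
    obtain i where "i < n" "e i = 1" using e_bij assms(2) by (auto simp: bij_betw_def image_iff)
    then have "v $ i = 1" "(0\<^sub>v n :: 'e vec) $ i = 0" by (simp_all add: v_def)
    then show False by (simp add: v_zero)
  qed
  moreover have "map_mat h A *\<^sub>v v = z \<cdot>\<^sub>v v"
  proof (rule eq_vecI)
    fix i assume "i < dim_vec (z \<cdot>\<^sub>v v)"
    then have i_less: "i < n" by (simp add: v_def)
    have "(map_mat h A *\<^sub>v v) $ i = (\<Sum>j\<in>{0..<n}. h (c (e i) (e j)) * e j)"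
      using i_less by (simp add: A_def v_def scalar_prod_def)
    also have "\<dots> = (\<Sum>u\<in>W. h (c (e i) u) * u)"
      by (rule sum.reindex_bij_betw[OF e_bij])
    also have "\<dots> = z * e i" using mult_eq_sum e_bij i_less by (auto simp: bij_betw_def)
    finally show "(map_mat h A *\<^sub>v v) $ i = (z \<cdot>\<^sub>v v) $ i" using i_less by (simp add: v_def)
  qed (simp add: A_def v_def)
  ultimately have "eigenvalue (map_mat h A) z"
    unfolding eigenvalue_def eigenvector_def by (intro exI[of _ v]) (simp add: A_def v_def)
  then show ?thesis by (intro integral_over_if_eigenvalue[of A n]) (simp add: A_def)
qed

lemma mult_in_span_if_mult_base_in_span:
  assumes "x \<in> base.span W" "\<And>w. w \<in> W \<Longrightarrow> z * w \<in> base.span U"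
  shows "z * x \<in> base.span U"
  using assms(1)
proof (induction rule: base.span_induct_alt)
  case (step a w y)
  then have "h a * (z * w) + z * y \<in> base.span U"
    using assms(2) by (intro base.span_add base.span_scale)
  then show ?case by (simp add: algebra_simps)
qed (simp add: base.span_zero)

lemma integral_over_imp_ex_stable:
  assumes "integral_over h z"
  shows "\<exists>W. finite W \<and> 1 \<in> W \<and> (\<forall>w\<in>W. z * w \<in> base.span W)"
proof -
  obtain p where monic_root: "lead_coeff p = 1" "poly (map_poly h p) z = 0"
    using assms unfolding integral_over_def by blast
  define n where "n = degree p"
  have lead: "coeff p n = 1" using monic_root(1) by (simp add: n_def)
  have "degree (map_poly h p) = n" unfolding n_def
    by (rule degree_map_poly) (use monic_root in auto)
  then have root: "(\<Sum>i\<le>n. h (coeff p i) * z ^ i) = 0"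
    using monic_root(2) by (simp add: poly_altdef)
  have n_pos: "n > 0" using root lead by (cases n) auto
  define W where "W = (\<lambda>i. z ^ i) ` {..<n}"
  have power_in_span: "z ^ i \<in> base.span W" if "i < n" for i
    by (rule base.span_base) (use that in \<open>auto simp: W_def\<close>)
  have "z * z ^ i \<in> base.span W" if "i < n" for i
  proof (cases "Suc i < n")
    case True
    then show ?thesis using power_in_span[of "Suc i"] by simp
  next
    case False
    then have "z * z ^ i = z ^ n" using that by (cases n) (auto simp: less_Suc_eq)
    also have "\<dots> = (\<Sum>i<n. h (- coeff p i) * z ^ i)"
      using root lead
      by (simp add: sum_negf hom_uminus eq_neg_iff_add_eq_0 add.commute flip: lessThan_Suc_atMost)
    also have "\<dots> \<in> base.span W" by (intro base.span_sum base.span_scale power_in_span) auto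
    finally show ?thesis .
  qed
  moreover have "1 \<in> W" unfolding W_def using n_pos by (auto intro!: image_eqI[of _ _ 0])
  ultimately show ?thesis by (intro exI[of _ W]) (auto simp: W_def)
qed

lemma integral_over_common_stable:
  assumes "integral_over h x" "integral_over h y"
  obtains W where "finite W" "1 \<in> W"
    "\<And>v. v \<in> base.span W \<Longrightarrow> x * v \<in> base.span W"
    "\<And>v. v \<in> base.span W \<Longrightarrow> y * v \<in> base.span W"
proof -
  obtain U where U_stable: "finite U" "1 \<in> U" "\<And>w. w \<in> U \<Longrightarrow> x * w \<in> base.span U"
    using integral_over_imp_ex_stable[OF assms(1)] by blast
  obtain V where V_stable: "finite V" "1 \<in> V" "\<And>w. w \<in> V \<Longrightarrow> y * w \<in> base.span V"
    using integral_over_imp_ex_stable[OF assms(2)] by blast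
  define W where "W = (\<lambda>(a, b). a * b) ` (U \<times> V)"
  have prod_in_span: "a * b \<in> base.span W" if "a \<in> U" "b \<in> V" for a b
    by (rule base.span_base) (use that in \<open>auto simp: W_def\<close>)
  have "x * w \<in> base.span W" if "w \<in> W" for w
  proof -
    obtain a b where w_eq: "a \<in> U" "b \<in> V" "w = a * b" using \<open>w \<in> W\<close> by (auto simp: W_def)
    have "b * (x * a) \<in> base.span W"
      by (rule mult_in_span_if_mult_base_in_span[OF U_stable(3)[OF w_eq(1)]])
         (use prod_in_span w_eq in \<open>simp add: mult.commute\<close>)
    then show ?thesis using w_eq by (simp add: ac_simps)
  qed
  moreover have "y * w \<in> base.span W" if "w \<in> W" for w
  proof -
    obtain a b where w_eq: "a \<in> U" "b \<in> V" "w = a * b" using \<open>w \<in> W\<close> by (auto simp: W_def)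
    have "a * (y * b) \<in> base.span W"
      by (rule mult_in_span_if_mult_base_in_span[OF V_stable(3)[OF w_eq(2)]]) (use prod_in_span w_eq in blast)
    then show ?thesis using w_eq by (simp add: ac_simps)
  qed
  moreover have "finite W" using U_stable V_stable by (simp add: W_def)
  moreover have "1 \<in> W" unfolding W_def
    by (rule image_eqI[of _ _ "(1, 1)"]) (use U_stable V_stable in auto)
  ultimately show thesis using that mult_in_span_if_mult_base_in_span by blast
qed

lemma integral_over_add:
  assumes "integral_over h x" "integral_over h y"
  shows "integral_over h (x + y)"
  using assms
proof (rule integral_over_common_stable)
  fix W assume W_stable: "finite W" "1 \<in> W"
    "\<And>v. v \<in> base.span W \<Longrightarrow> x * v \<in> base.span W"
    "\<And>v. v \<in> base.span W \<Longrightarrow> y * v \<in> base.span W"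
  show ?thesis
    by (rule integral_over_if_stable[of W])
       (use W_stable in \<open>auto simp: distrib_right intro: base.span_add base.span_base\<close>)
qed

lemma integral_over_mult:
  assumes "integral_over h x" "integral_over h y"
  shows "integral_over h (x * y)"
  using assms
proof (rule integral_over_common_stable)
  fix W assume W_stable: "finite W" "1 \<in> W"
    "\<And>v. v \<in> base.span W \<Longrightarrow> x * v \<in> base.span W"
    "\<And>v. v \<in> base.span W \<Longrightarrow> y * v \<in> base.span W"
  show ?thesis
    by (rule integral_over_if_stable[of W]) (use W_stable in \<open>auto simp: mult.assoc intro: base.span_base\<close>)
qed

lemma integral_over_base: "integral_over h (h a)"
  unfolding integral_over_def by (rule exI[of _ "[:- a, 1:]"]) (simp add: hom_uminus)

lemma integral_over_0: "integral_over h 0" and integral_over_1: "integral_over h 1"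
  using integral_over_base[of 0] integral_over_base[of 1] by simp_all

lemma integral_over_uminus: "integral_over h x \<Longrightarrow> integral_over h (- x)"
  using integral_over_mult[OF integral_over_base[of "-1"], of x] by (simp add: hom_uminus)

lemma integral_over_diff: "integral_over h x \<Longrightarrow> integral_over h y \<Longrightarrow> integral_over h (x - y)"
  using integral_over_add[of x "- y"] integral_over_uminus by simp

lemma integral_over_power: "integral_over h x \<Longrightarrow> integral_over h (x ^ n)"
  by (induction n) (auto intro: integral_over_mult integral_over_1)

end

lemma integral_over_hom:
  assumes "comm_ring_hom f" "comm_ring_hom h" "comm_ring_hom g" "comm_ring_hom k"
    and commute: "\<And>a. f (h a) = g (k a)" and "integral_over h z"
  shows "integral_over g (f z)"
proof -
  interpret f: comm_ring_hom f by fact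
  interpret h: comm_ring_hom h by fact
  interpret g: comm_ring_hom g by fact
  interpret k: comm_ring_hom k by fact
  obtain p where monic_root: "lead_coeff p = 1" "poly (map_poly h p) z = 0"
    using assms(6) by (auto simp: integral_over_def)
  have "map_poly g (map_poly k p) = map_poly f (map_poly h p)"
    by (rule poly_eqI) (simp add: commute)
  then have "poly (map_poly g (map_poly k p)) (f z) = 0" using monic_root(2) by simp
  moreover have "degree (map_poly k p) = degree p"
    by (rule degree_map_poly) (use monic_root(1) in auto)
  then have "lead_coeff (map_poly k p) = 1" using monic_root(1) by simp
  ultimately show ?thesis unfolding integral_over_def by blast
qed

section \<open>Extending embeddings of fields\<close>

definition polys_over :: "'e::zero set \<Rightarrow> 'e poly set" where
  "polys_over S = {p. \<forall>i. coeff p i \<in> S}"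

locale subfield_set =
  fixes S :: "'e::field set"
  assumes is_subfield: "is_subfield S"
begin

lemma zero_closed: "0 \<in> S" and one_closed: "1 \<in> S"
  and add_closed: "x \<in> S \<Longrightarrow> y \<in> S \<Longrightarrow> x + y \<in> S"
  and mult_closed: "x \<in> S \<Longrightarrow> y \<in> S \<Longrightarrow> x * y \<in> S"
  and uminus_closed: "x \<in> S \<Longrightarrow> - x \<in> S"
  and inverse_closed: "x \<in> S \<Longrightarrow> inverse x \<in> S"
  using is_subfield by (auto simp: is_subfield_def)

lemma diff_closed: "x \<in> S \<Longrightarrow> y \<in> S \<Longrightarrow> x - y \<in> S"
  using add_closed[of x "- y"] uminus_closed by simp

lemma divide_closed: "x \<in> S \<Longrightarrow> y \<in> S \<Longrightarrow> x / y \<in> S"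
  by (simp add: divide_inverse mult_closed inverse_closed)

lemma sum_closed: "(\<And>i. i \<in> A \<Longrightarrow> f i \<in> S) \<Longrightarrow> (\<Sum>i\<in>A. f i) \<in> S"
  by (induction A rule: infinite_finite_induct) (auto intro: zero_closed add_closed)

lemma pCons_in_polys_over_iff: "pCons a p \<in> polys_over S \<longleftrightarrow> a \<in> S \<and> p \<in> polys_over S"
  by (auto simp: polys_over_def coeff_pCons split: nat.splits)

lemma zero_in_polys_over: "0 \<in> polys_over S" and one_in_polys_over: "1 \<in> polys_over S"
  and add_in_polys_over: "p \<in> polys_over S \<Longrightarrow> r \<in> polys_over S \<Longrightarrow> p + r \<in> polys_over S"
  and diff_in_polys_over: "p \<in> polys_over S \<Longrightarrow> r \<in> polys_over S \<Longrightarrow> p - r \<in> polys_over S"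
  and uminus_in_polys_over: "p \<in> polys_over S \<Longrightarrow> - p \<in> polys_over S"
  by (auto simp: polys_over_def one_pCons coeff_pCons zero_closed one_closed add_closed diff_closed uminus_closed
      split: nat.split)

lemma mult_in_polys_over: "p \<in> polys_over S \<Longrightarrow> r \<in> polys_over S \<Longrightarrow> p * r \<in> polys_over S"
  unfolding polys_over_def mem_Collect_eq coeff_mult by (intro allI sum_closed mult_closed) auto

lemma smult_in_polys_over: "c \<in> S \<Longrightarrow> p \<in> polys_over S \<Longrightarrow> smult c p \<in> polys_over S"
  by (simp add: polys_over_def mult_closed)

lemma div_mod_in_polys_over:
  assumes "p \<in> polys_over S" "r \<in> polys_over S"
  shows "p div r \<in> polys_over S \<and> p mod r \<in> polys_over S"
  using assms(1)
proof (induction p)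
  case (pCons a p)
  let ?c = "coeff (pCons a (p mod r)) (degree r) / lead_coeff r"
  have closed: "a \<in> S" "p div r \<in> polys_over S" "p mod r \<in> polys_over S"
    using pCons by (auto simp: pCons_in_polys_over_iff)
  then have shifted: "pCons a (p mod r) \<in> polys_over S" by (simp add: pCons_in_polys_over_iff)
  then have quotient_in_S: "?c \<in> S"
    using assms(2) unfolding polys_over_def by (intro divide_closed) auto
  then have "smult ?c r \<in> polys_over S" using assms(2) by (rule smult_in_polys_over)
  then show ?case using pCons.prems closed shifted quotient_in_S
    by (simp add: div_pCons_eq mod_pCons_eq pCons_in_polys_over_iff zero_in_polys_over diff_in_polys_over)
qed (simp add: zero_in_polys_over)

lemmas div_in_polys_over = div_mod_in_polys_over[THEN conjunct1]
  and mod_in_polys_over = div_mod_in_polys_over[THEN conjunct2]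

definition is_min_poly :: "'e poly \<Rightarrow> 'e \<Rightarrow> bool" where
  "is_min_poly P r \<longleftrightarrow> P \<in> polys_over S \<and> P \<noteq> 0 \<and> poly P r = 0 \<and>
     (\<forall>Q\<in>polys_over S. poly Q r = 0 \<longrightarrow> P dvd Q)"

lemma ex_is_min_poly:
  assumes "p \<in> polys_over S" "p \<noteq> 0" "poly p r = 0"
  shows "\<exists>P. is_min_poly P r"
proof -
  obtain P where P_root: "P \<in> polys_over S" "P \<noteq> 0" "poly P r = 0"
    and min: "\<And>Q. Q \<in> polys_over S \<Longrightarrow> Q \<noteq> 0 \<Longrightarrow> poly Q r = 0 \<Longrightarrow> degree P \<le> degree Q"
    using ex_has_least_nat[of "\<lambda>P. P \<in> polys_over S \<and> P \<noteq> 0 \<and> poly P r = 0" p degree] assms by blast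
  have "P dvd Q" if Q_root: "Q \<in> polys_over S" "poly Q r = 0" for Q
  proof -
    have "poly (Q mod P) r = 0" using Q_root(2) P_root(3) by (simp flip: minus_div_mult_eq_mod)
    moreover have "Q mod P \<in> polys_over S" using Q_root(1) P_root(1) by (rule mod_in_polys_over)
    ultimately have "Q mod P = 0"
      using min[of "Q mod P"] degree_mod_less[OF P_root(2), of Q] by fastforce
    then show ?thesis by (simp add: mod_eq_0_iff_dvd)
  qed
  then show ?thesis using P_root unfolding is_min_poly_def by blast
qed

lemma degree_is_min_poly: "is_min_poly P r \<Longrightarrow> degree P > 0"
  unfolding is_min_poly_def by (metis degree_eq_zeroE gr0I pCons_0_0 poly_const_conv)

lemma ex_inverse_at_root:
  assumes "is_min_poly P r" "Q \<in> polys_over S" "poly Q r \<noteq> 0"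
  shows "\<exists>C\<in>polys_over S. poly C r * poly Q r = 1"
proof -
  have P_root: "P \<in> polys_over S" "P \<noteq> 0" "poly P r = 0"
    and min: "\<And>Q. Q \<in> polys_over S \<Longrightarrow> poly Q r = 0 \<Longrightarrow> P dvd Q"
    using assms(1) by (auto simp: is_min_poly_def)
  obtain u v where uv_in: "u \<in> polys_over S" "v \<in> polys_over S"
    and dvd: "u * P + v * Q dvd P" "u * P + v * Q dvd Q"
    using bezout_in_subring[OF zero_in_polys_over one_in_polys_over diff_in_polys_over mult_in_polys_over
        div_in_polys_over P_root(1) assms(2)] by blast
  define D where "D = u * P + v * Q"
  have D_in: "D \<in> polys_over S" unfolding D_def
    by (intro add_in_polys_over mult_in_polys_over uv_in P_root(1) assms(2))
  have P_eq: "P = D * (P div D)" using dvd(1) by (simp add: D_def)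
  have "poly D r \<noteq> 0" using dvd(2) assms(3) unfolding D_def[symmetric] by (auto elim: dvdE)
  then have "poly (P div D) r = 0" using P_root(3) P_eq by (metis mult_eq_0_iff poly_mult)
  then have "P dvd P div D" using div_in_polys_over[OF P_root(1) D_in] by (rule min[rotated])
  then have "degree P \<le> degree (P div D)"
    using P_root(2) P_eq by (intro dvd_imp_degree_le) auto
  moreover have "degree P = degree D + degree (P div D)"
    using P_root(2) P_eq by (metis degree_mult_eq mult_eq_0_iff)
  ultimately obtain c where D_eq: "D = [:c:]"
    by (metis add_le_same_cancel2 degree_eq_zeroE le_zero_eq)
  have "poly D r = poly v r * poly Q r" using P_root(3) by (simp add: D_def)
  then have "poly v r * poly Q r = c" using D_eq by simp
  moreover have "c \<noteq> 0" using D_eq P_root(2) P_eq by auto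
  ultimately have "poly (smult (inverse c) v) r * poly Q r = 1" by (simp add: mult.assoc)
  moreover have "c \<in> S" using D_in unfolding D_eq by (simp add: pCons_in_polys_over_iff)
  then have "smult (inverse c) v \<in> polys_over S"
    using uv_in(2) by (intro smult_in_polys_over inverse_closed)
  ultimately show ?thesis by blast
qed

definition adjoin :: "'e \<Rightarrow> 'e set" where
  "adjoin r = (\<lambda>Q. poly Q r) ` polys_over S"

lemma poly_in_adjoin: "Q \<in> polys_over S \<Longrightarrow> poly Q r \<in> adjoin r"
  by (simp add: adjoin_def)

lemma subset_adjoin: "S \<subseteq> adjoin r"
proof
  fix x assume "x \<in> S"
  then show "x \<in> adjoin r"
    using poly_in_adjoin[of "[:x:]" r] by (simp add: pCons_in_polys_over_iff zero_in_polys_over)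
qed

lemma in_adjoin: "r \<in> adjoin r"
  using poly_in_adjoin[of "[:0, 1:]" r]
  by (simp add: pCons_in_polys_over_iff zero_in_polys_over zero_closed one_closed)

lemma is_subfield_adjoin:
  assumes "is_min_poly P r"
  shows "is_subfield (adjoin r)"
  unfolding is_subfield_def
proof (intro conjI ballI)
  show "0 \<in> adjoin r" "1 \<in> adjoin r" using subset_adjoin zero_closed one_closed by auto
next
  fix x y assume "x \<in> adjoin r" "y \<in> adjoin r"
  then obtain Q R where "Q \<in> polys_over S" "R \<in> polys_over S" "x = poly Q r" "y = poly R r"
    by (auto simp: adjoin_def)
  then show "x + y \<in> adjoin r" "x * y \<in> adjoin r"
    using poly_in_adjoin[OF add_in_polys_over, of Q R r] poly_in_adjoin[OF mult_in_polys_over, of Q R r]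
    by simp_all
next
  fix x assume "x \<in> adjoin r"
  then obtain Q where x_eq: "Q \<in> polys_over S" "x = poly Q r" by (auto simp: adjoin_def)
  then show "- x \<in> adjoin r"
    using poly_in_adjoin[OF uminus_in_polys_over, of Q r] by simp
  show "inverse x \<in> adjoin r"
  proof (cases "x = 0")
    case False
    then obtain C where C_inverse: "C \<in> polys_over S" "poly C r * x = 1"
      using ex_inverse_at_root[OF assms] x_eq by blast
    then have "inverse x = poly C r" by (metis inverse_unique mult.commute)
    then show ?thesis using C_inverse(1) by (simp add: poly_in_adjoin)
  qed (use subset_adjoin zero_closed in auto)
qed

end

locale subfield_hom = subfield_set S for S :: "'e::field set" +
  fixes g :: "'e \<Rightarrow> 'f::field"
  assumes g_one: "g 1 = 1"
    and g_add: "x \<in> S \<Longrightarrow> y \<in> S \<Longrightarrow> g (x + y) = g x + g y"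
    and g_mult: "x \<in> S \<Longrightarrow> y \<in> S \<Longrightarrow> g (x * y) = g x * g y"
begin

lemma g_zero: "g 0 = 0"
  using g_add[OF zero_closed zero_closed] by (metis add_0 add_cancel_right_left)

lemma g_diff: "x \<in> S \<Longrightarrow> y \<in> S \<Longrightarrow> g (x - y) = g x - g y"
  using g_add[of "x - y" y] diff_closed by (simp add: eq_diff_eq)

lemma g_sum: "(\<And>i. i \<in> A \<Longrightarrow> f i \<in> S) \<Longrightarrow> g (\<Sum>i\<in>A. f i) = (\<Sum>i\<in>A. g (f i))"
  by (induction A rule: infinite_finite_induct) (auto simp: g_zero g_add sum_closed)

lemma g_eq_zeroD: "x \<in> S \<Longrightarrow> g x = 0 \<Longrightarrow> x = 0"
  using g_mult[of x "inverse x"] inverse_closed[of x] g_one by (cases "x = 0") auto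

lemma coeff_map_poly_g [simp]: "coeff (map_poly g p) i = g (coeff p i)"
  by (simp add: coeff_map_poly g_zero)

lemma map_poly_g_add:
  "p \<in> polys_over S \<Longrightarrow> r \<in> polys_over S \<Longrightarrow> map_poly g (p + r) = map_poly g p + map_poly g r"
  by (rule poly_eqI) (auto simp: polys_over_def g_add)

lemma map_poly_g_diff:
  "p \<in> polys_over S \<Longrightarrow> r \<in> polys_over S \<Longrightarrow> map_poly g (p - r) = map_poly g p - map_poly g r"
  by (rule poly_eqI) (auto simp: polys_over_def g_diff)

lemma map_poly_g_mult:
  "p \<in> polys_over S \<Longrightarrow> r \<in> polys_over S \<Longrightarrow> map_poly g (p * r) = map_poly g p * map_poly g r"
  by (rule poly_eqI) (auto simp: polys_over_def coeff_mult g_sum g_mult mult_closed)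

lemma degree_map_poly_g: "p \<in> polys_over S \<Longrightarrow> degree (map_poly g p) = degree p"
  by (cases "p = 0", simp, rule degree_map_poly)
     (use g_eq_zeroD[of "lead_coeff p"] in \<open>auto simp: polys_over_def\<close>)

text \<open>If \<open>p = D P\<close> and the image of \<open>P\<close> had no root, the image of \<open>p\<close> would have at most \<open>degree D\<close> roots.\<close>

lemma ex_root_of_factor:
  assumes "p \<in> polys_over S" "P \<in> polys_over S" "P dvd p" "degree P > 0"
    and split: "card {x. poly (map_poly g p) x = 0} = degree p" "p \<noteq> 0"
  shows "\<exists>r'. poly (map_poly g P) r' = 0"
proof (rule ccontr)
  assume no_root: "\<nexists>r'. poly (map_poly g P) r' = 0"
  define D where "D = p div P"
  have D_eq: "D \<in> polys_over S" "p = D * P"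
    using assms(1-3) by (simp_all add: D_def div_in_polys_over)
  have "D \<noteq> 0" "P \<noteq> 0" using D_eq split(2) by auto
  then have D_image: "map_poly g D \<noteq> 0"
    using D_eq(1) by (metis coeff_map_poly_g coeff_0 g_eq_zeroD leading_coeff_0_iff mem_Collect_eq polys_over_def)
  have "{x. poly (map_poly g p) x = 0} = {x. poly (map_poly g D) x = 0}"
    using no_root D_eq assms(2) by (auto simp: map_poly_g_mult)
  then have "degree p \<le> degree (map_poly g D)"
    using card_poly_roots_bound[OF D_image] split(1) by simp
  also have "\<dots> = degree D" by (rule degree_map_poly_g[OF D_eq(1)])
  also have "\<dots> < degree p"
    using D_eq(2) \<open>D \<noteq> 0\<close> \<open>P \<noteq> 0\<close> assms(4) by (simp add: degree_mult_eq)
  finally show False by simp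
qed

lemma ex_extension_to_adjoin:
  assumes min_poly: "is_min_poly P r" and root: "poly (map_poly g P) r' = 0"
  shows "\<exists>g'. subfield_hom (adjoin r) g' \<and> (\<forall>x\<in>S. g' x = g x)"
proof -
  define g' where "g' z = poly (map_poly g (SOME Q. Q \<in> polys_over S \<and> poly Q r = z)) r'" for z
  have g'_poly: "g' (poly Q r) = poly (map_poly g Q) r'" if Q_in: "Q \<in> polys_over S" for Q
  proof -
    define Q' where "Q' = (SOME Q'. Q' \<in> polys_over S \<and> poly Q' r = poly Q r)"
    have Q'_in: "Q' \<in> polys_over S" "poly Q' r = poly Q r"
      using someI[of "\<lambda>Q'. Q' \<in> polys_over S \<and> poly Q' r = poly Q r" Q] Q_in by (auto simp: Q'_def)
    have diff: "Q' - Q \<in> polys_over S" by (rule diff_in_polys_over[OF Q'_in(1) Q_in])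
    then have "P dvd Q' - Q" using min_poly Q'_in(2) by (simp add: is_min_poly_def)
    then have "map_poly g (Q' - Q) = map_poly g ((Q' - Q) div P) * map_poly g P"
      using min_poly diff by (subst map_poly_g_mult[symmetric]) (auto simp: is_min_poly_def div_in_polys_over)
    then have "poly (map_poly g Q' - map_poly g Q) r' = 0"
      using root Q_in Q'_in(1) by (simp add: map_poly_g_diff)
    then show ?thesis by (simp add: g'_def Q'_def)
  qed
  have g'_base: "g' x = g x" if "x \<in> S" for x
  proof -
    have "map_poly g [:x:] = [:g x:]"
      by (rule poly_eqI) (simp add: coeff_pCons g_zero split: nat.split)
    then show ?thesis
      using g'_poly[of "[:x:]"] that by (simp add: pCons_in_polys_over_iff zero_in_polys_over)
  qed
  have "subfield_hom (adjoin r) g'"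
  proof
    show "is_subfield (adjoin r)" using min_poly by (rule is_subfield_adjoin)
    show "g' 1 = 1" using g'_base[OF one_closed] g_one by simp
    fix x y assume "x \<in> adjoin r" "y \<in> adjoin r"
    then obtain Q R where xy_eq: "Q \<in> polys_over S" "R \<in> polys_over S" "x = poly Q r" "y = poly R r"
      by (auto simp: adjoin_def)
    show "g' (x + y) = g' x + g' y"
      using g'_poly[OF add_in_polys_over[OF xy_eq(1,2)]] xy_eq by (simp add: g'_poly map_poly_g_add)
    show "g' (x * y) = g' x * g' y"
      using g'_poly[OF mult_in_polys_over[OF xy_eq(1,2)]] xy_eq by (simp add: g'_poly map_poly_g_mult)
  qed
  then show ?thesis using g'_base by blast
qed

lemma ex_extension_to_roots:
  assumes p_splits: "p \<in> polys_over S" "p \<noteq> 0" "card {x. poly (map_poly g p) x = 0} = degree p"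
    and A_roots: "finite A" "\<And>r. r \<in> A \<Longrightarrow> poly p r = 0"
  shows "\<exists>T g'. subfield_hom T g' \<and> S \<subseteq> T \<and> A \<subseteq> T \<and> (\<forall>x\<in>S. g' x = g x)"
  using A_roots
proof (induction A rule: finite_induct)
  case empty
  show ?case using subfield_hom_axioms by blast
next
  case (insert r A)
  then obtain T g' where T_hom: "subfield_hom T g'" "S \<subseteq> T" "A \<subseteq> T" "\<forall>x\<in>S. g' x = g x" by auto
  interpret T: subfield_hom T g' by (rule T_hom(1))
  have p_T: "p \<in> polys_over T" using p_splits(1) T_hom(2) by (auto simp: polys_over_def)
  have "map_poly g' p = map_poly g p"
    by (rule poly_eqI) (use T_hom(4) p_splits(1) in \<open>auto simp: polys_over_def\<close>)
  then have split: "card {x. poly (map_poly g' p) x = 0} = degree p" using p_splits(3) by simp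
  obtain P where min_poly: "T.is_min_poly P r"
    using T.ex_is_min_poly[OF p_T p_splits(2)] insert.prems by auto
  then have "P \<in> polys_over T" "P dvd p" using p_T insert.prems by (auto simp: T.is_min_poly_def)
  then obtain r' where "poly (map_poly g' P) r' = 0"
    using T.ex_root_of_factor[OF p_T _ _ T.degree_is_min_poly[OF min_poly] split p_splits(2)] by blast
  then obtain f where "subfield_hom (T.adjoin r) f" "\<forall>x\<in>T. f x = g' x"
    using T.ex_extension_to_adjoin[OF min_poly] by blast
  then show ?case
    using T_hom T.subset_adjoin[of r] T.in_adjoin[of r]
    by (intro exI[of _ "T.adjoin r"] exI[of _ f]) (auto simp: subset_iff)
qed

end

section \<open>Embeddings and automorphisms of splitting fields\<close>

lemma is_subfield_range:
  assumes "field_hom g"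
  shows "is_subfield (range g)"
proof -
  interpret field_hom g by (rule assms)
  show ?thesis unfolding is_subfield_def
    by (auto simp flip: hom_zero hom_one hom_add hom_mult hom_uminus hom_inverse)
qed

lemma is_subfield_vimage:
  assumes "field_hom g" "is_subfield S"
  shows "is_subfield (g -` S)"
proof -
  interpret field_hom g by (rule assms)
  show ?thesis using assms(2) unfolding is_subfield_def
    by (simp add: hom_add hom_mult hom_uminus hom_inverse)
qed

lemma field_hom_comp:
  assumes "field_hom f" "field_hom g"
  shows "field_hom (\<lambda>x. f (g x))"
proof -
  interpret f: field_hom f by fact
  interpret g: field_hom g by fact
  show ?thesis by unfold_locales (simp_all add: f.hom_add f.hom_mult g.hom_add g.hom_mult)
qed

lemma gal_group_funpow:
  assumes "s \<in> gal_group emb"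
  shows "s ^^ n \<in> gal_group emb"
proof (induction n)
  case 0
  show ?case by (simp add: gal_group_def bij_id[unfolded id_def])
next
  case (Suc n)
  have "bij (s ^^ Suc n)" using assms by (simp only: gal_group_def mem_Collect_eq bij_fn)
  then show ?case using Suc assms by (simp add: gal_group_def comp_def)
qed

lemma gal_group_inv:
  assumes "s \<in> gal_group emb"
  shows "inv s \<in> gal_group emb"
proof -
  have s_hom: "bij s" "\<And>x y. s (x + y) = s x + s y"
    "\<And>x y. s (x * y) = s x * s y" "\<And>a. s (emb a) = emb a"
    using assms by (auto simp: gal_group_def)
  have s_inv: "s (inv s x) = x" for x using s_hom(1) by (simp add: bij_is_surj surj_f_inv_f)
  have eqI: "x = y" if "s x = s y" for x y using s_hom(1) that by (auto simp: bij_def dest: injD)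
  have "inv s (x + y) = inv s x + inv s y" "inv s (x * y) = inv s x * inv s y" "inv s (emb a) = emb a" for x y a
    by (rule eqI, simp add: s_inv s_hom)+
  then show ?thesis using bij_imp_bij_inv[OF s_hom(1)] by (simp add: gal_group_def)
qed

locale splitting_field =
  fixes emb :: "'k::field \<Rightarrow> 'e::field" and p :: "'k poly"
  assumes splitting: "is_splitting_field emb p"
begin

sublocale emb: field_hom emb
  using splitting unfolding is_splitting_field_def field_embedding_def by unfold_locales auto

lemma p_nonzero: "p \<noteq> 0"
  using splitting by (simp add: is_splitting_field_def)

lemma generated: "is_subfield S \<Longrightarrow> range emb \<subseteq> S \<Longrightarrow> roots_in emb p \<subseteq> S \<Longrightarrow> S = UNIV"
  using splitting by (auto simp: is_splitting_field_def)

lemma image_roots: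
  assumes "field_hom f" and f_emb: "\<And>x. f (emb x) = j x"
  shows "f ` roots_in emb p = roots_in j p"
proof -
  interpret f: field_hom f by fact
  interpret map_f: map_poly_comm_ring_hom f ..
  obtain c rs where factors: "map_poly emb p = smult c (\<Prod>r\<leftarrow>rs. [:- r, 1:])"
    using splitting unfolding is_splitting_field_def by blast
  have "c \<noteq> 0" using factors p_nonzero by auto
  have "map_poly j p = map_poly f (map_poly emb p)"
    by (rule poly_eqI) (simp add: f_emb[symmetric] coeff_map_poly)
  moreover have "map_poly f (\<Prod>r\<leftarrow>rs. [:- r, 1:]) = (\<Prod>r\<leftarrow>rs. [:- f r, 1:])"
    by (simp only: map_f.hom_prod_list map_map comp_def f.map_poly_pCons_hom f.hom_uminus f.hom_one map_poly_0)
  ultimately have image_factors: "map_poly j p = smult (f c) (\<Prod>r\<leftarrow>rs. [:- f r, 1:])"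
    by (simp only: factors f.map_poly_hom_smult)
  have "roots_in emb p = set rs" "roots_in j p = f ` set rs"
    using \<open>c \<noteq> 0\<close> unfolding roots_in_def factors image_factors
    by (auto simp: poly_prod_list prod_list_zero_iff)
  then show ?thesis by simp
qed

lemma ex_embedding:
  assumes "field_hom j" "card (roots_in j p) = degree p"
  shows "\<exists>f. field_hom f \<and> (\<forall>x. f (emb x) = j x)"
proof -
  interpret j: field_hom j by fact
  define g where "g z = j (inv emb z)" for z
  have g_emb: "g (emb x) = j x" for x by (simp add: g_def)
  interpret base: subfield_hom "range emb" g
  proof
    show "is_subfield (range emb)" by (rule is_subfield_range[OF emb.field_hom_axioms])
    show "g 1 = 1" using g_emb[of 1] by simp
    fix x y assume "x \<in> range emb" "y \<in> range emb"
    then obtain a b where [simp]: "x = emb a" "y = emb b" by auto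
    show "g (x + y) = g x + g y" using g_emb[of "a + b"] by (simp add: g_emb emb.hom_add j.hom_add)
    show "g (x * y) = g x * g y"
      using g_emb[of "a * b"] by (simp add: g_emb emb.hom_mult j.hom_mult)
  qed
  have "\<exists>T f. subfield_hom T f \<and> range emb \<subseteq> T \<and> roots_in emb p \<subseteq> T \<and> (\<forall>x\<in>range emb. f x = g x)"
  proof (rule base.ex_extension_to_roots)
    show "map_poly emb p \<in> polys_over (range emb)" by (simp add: polys_over_def)
    show "map_poly emb p \<noteq> 0" using p_nonzero by simp
    have "map_poly g (map_poly emb p) = map_poly j p"
      by (rule poly_eqI) (simp add: g_emb)
    then show "card {x. poly (map_poly g (map_poly emb p)) x = 0} = degree (map_poly emb p)"
      using assms(2) by (simp add: roots_in_def)
    show "finite (roots_in emb p)"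
      unfolding roots_in_def using p_nonzero by (intro poly_roots_finite) simp
  qed (simp add: roots_in_def)
  then obtain T f where T_hom: "subfield_hom T f" "range emb \<subseteq> T" "roots_in emb p \<subseteq> T"
    and f_emb: "\<And>x. f (emb x) = j x" by (auto simp: g_emb)
  interpret f: subfield_hom T f by (rule T_hom(1))
  have "T = UNIV" using generated[OF f.is_subfield] T_hom by blast
  then have "field_hom f" by unfold_locales (simp_all add: f.g_zero f.g_one f.g_add f.g_mult)
  then show ?thesis using f_emb by blast
qed

lemma range_embeddings_eq:
  fixes f g :: "'e \<Rightarrow> 'f::field"
  assumes "field_hom f" "field_hom g" "\<And>x. f (emb x) = g (emb x)"
  shows "range f = range g"
proof -
  have "range f \<subseteq> range g" if "field_hom f" "field_hom g" "\<And>x. f (emb x) = g (emb x)"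
    for f g :: "'e \<Rightarrow> 'f"
  proof -
    have "f ` roots_in emb p = g ` roots_in emb p"
      using image_roots[OF that(1), of "\<lambda>x. g (emb x)"] image_roots[OF that(2), of "\<lambda>x. g (emb x)"] that(3)
      by simp
    then have "f ` roots_in emb p \<subseteq> range g" by auto
    then have "f -` range g = UNIV"
      by (intro generated is_subfield_vimage[OF that(1) is_subfield_range[OF that(2)]]) (auto simp: that(3))
    then show ?thesis by auto
  qed
  from this[OF assms] this[OF assms(2,1)] assms(3) show ?thesis by simp
qed

lemma gal_groupI:
  assumes "field_hom s" "surj s" "\<And>x. s (emb x) = emb x"
  shows "s \<in> gal_group emb"
proof -
  interpret s: field_hom s by fact
  show ?thesis using assms(2,3) s.inj_f by (simp add: gal_group_def bij_def s.hom_add s.hom_mult)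
qed

lemma gal_group_field_hom:
  assumes "s \<in> gal_group emb"
  shows "field_hom s"
proof -
  have s_emb: "s (emb a) = emb a" for a using assms by (simp add: gal_group_def)
  show ?thesis
    by unfold_locales (use assms s_emb[of 0] s_emb[of 1] in \<open>simp_all add: gal_group_def\<close>)
qed

lemma gal_group_image_roots:
  assumes "s \<in> gal_group emb"
  shows "s ` roots_in emb p = roots_in emb p"
  by (rule image_roots[OF gal_group_field_hom[OF assms]]) (use assms in \<open>simp add: gal_group_def\<close>)

lemma ex_gal_group_lift:
  assumes "field_hom f" "field_hom \<phi>" "\<And>x. \<phi> (f (emb x)) = f (emb x)"
  shows "\<exists>\<sigma>\<in>gal_group emb. \<forall>z. f (\<sigma> z) = \<phi> (f z)"
proof -
  interpret f: field_hom f by fact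
  interpret \<phi>: field_hom \<phi> by fact
  have range_eq: "range (\<lambda>z. \<phi> (f z)) = range f"
    by (rule range_embeddings_eq[OF field_hom_comp[OF assms(2,1)] assms(1,3)])
  define \<sigma> where "\<sigma> z = inv f (\<phi> (f z))" for z
  have f_\<sigma>: "f (\<sigma> z) = \<phi> (f z)" for z
    unfolding \<sigma>_def by (rule f_inv_into_f) (use range_eq in blast)
  have f_eq: "f x = f y \<longleftrightarrow> x = y" for x y by simp
  have "field_hom \<sigma>"
    by unfold_locales (simp_all add: f_\<sigma> f.hom_add f.hom_mult \<phi>.hom_add \<phi>.hom_mult flip: f_eq)
  moreover have "surj \<sigma>"
  proof (rule surjI)
    fix y
    have "f y \<in> range (\<lambda>z. \<phi> (f z))" using range_eq by simp
    then have "\<phi> (f (SOME z. f y = \<phi> (f z))) = f y" by (auto intro: someI2)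
    then show "\<sigma> (SOME z. f y = \<phi> (f z)) = y" by (simp add: f_\<sigma> flip: f_eq)
  qed
  moreover have "\<sigma> (emb x) = emb x" for x by (simp add: f_\<sigma> assms(3) flip: f_eq)
  ultimately show ?thesis using gal_groupI f_\<sigma> by blast
qed

end

section \<open>Power series and Laurent series\<close>

lemma poly_add_taylor:
  fixes P :: "'a::idom poly"
  shows "\<exists>r. poly P (y + d) = poly P y + d * poly (pderiv P) y + d ^ 2 * r"
proof (induction P)
  case (pCons a P)
  then obtain r where taylor: "poly P (y + d) = poly P y + d * poly (pderiv P) y + d ^ 2 * r"
    by blast
  have "poly (pCons a P) (y + d) = poly (pCons a P) y + d * poly (pderiv (pCons a P)) y
      + d ^ 2 * (poly (pderiv P) y + (y + d) * r)"
    unfolding poly_pCons taylor pderiv_pCons poly_add by (simp add: algebra_simps power2_eq_square)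
  then show ?case by blast
qed (auto intro: exI[of _ 0])

interpretation fps_nth_0: comm_ring_hom "\<lambda>f :: 'a::comm_ring_1 fps. fps_nth f 0"
  by unfold_locales simp_all

lemma poly_fps_nth_cong:
  fixes P :: "'k::idom fps poly"
  assumes "\<And>i. i \<le> n \<Longrightarrow> fps_nth f i = fps_nth g i"
  shows "fps_nth (poly P f) n = fps_nth (poly P g) n"
proof -
  obtain r where "poly P (g + (f - g)) = poly P g + (f - g) * poly (pderiv P) g + (f - g) ^ 2 * r"
    using poly_add_taylor by blast
  then have "poly P f - poly P g = (f - g) * (poly (pderiv P) g + (f - g) * r)"
    by (simp add: algebra_simps power2_eq_square)
  then have "fps_nth (poly P f - poly P g) n = 0" by (simp add: fps_mult_nth assms)
  then show ?thesis by simp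
qed

lemma fps_newton_step:
  fixes P :: "'k::field fps poly"
  assumes "fps_nth (poly (pderiv P) f) 0 \<noteq> 0" "n > 0"
    and "\<And>i. i < n \<Longrightarrow> fps_nth (poly P f) i = 0" "i \<le> n"
  defines "c \<equiv> - fps_nth (poly P f) n / fps_nth (poly (pderiv P) f) 0"
  shows "fps_nth (poly P (f + fps_const c * fps_X ^ n)) i = 0"
proof -
  let ?d = "fps_const c * fps_X ^ n"
  obtain r where "poly P (f + ?d) = poly P f + ?d * poly (pderiv P) f + ?d ^ 2 * r"
    using poly_add_taylor by blast
  also have "\<dots> = poly P f +
      fps_X ^ n * (fps_const c * poly (pderiv P) f + fps_X ^ n * (fps_const (c ^ 2) * r))"
    by (simp add: algebra_simps power2_eq_square)
  finally have "fps_nth (poly P (f + ?d)) i = fps_nth (poly P f) i +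
      (if i < n then 0 else c * fps_nth (poly (pderiv P) f) (i - n))"
    using assms(2,4) by (simp add: fps_X_power_mult_nth)
  then show ?thesis using assms by (cases "i < n") simp_all
qed

lemma fps_hensel:
  fixes P :: "'k::field fps poly"
  defines "p \<equiv> map_poly (\<lambda>f. fps_nth f 0) P"
  assumes "poly p a = 0" "poly (pderiv p) a \<noteq> 0"
  shows "\<exists>f. fps_nth f 0 = a \<and> poly P f = 0"
proof -
  interpret idom_hom "\<lambda>f :: 'k fps. fps_nth f 0" ..
  have nth_0: "fps_nth (poly P f) 0 = poly p (fps_nth f 0)"
    "fps_nth (poly (pderiv P) f) 0 = poly (pderiv p) (fps_nth f 0)" for f
    by (simp_all add: p_def flip: map_poly_pderiv)
  define step where "step n f =
      f + fps_const (- fps_nth (poly P f) (Suc n) / fps_nth (poly (pderiv P) f) 0) * fps_X ^ Suc n" for n f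
  define F where "F = rec_nat (fps_const a) step"
  have F_0: "F 0 = fps_const a" and F_Suc: "F (Suc n) = step n (F n)" for n by (simp_all add: F_def)
  have F_nth_0: "fps_nth (F n) 0 = a" for n by (induction n) (simp_all add: F_0 F_Suc step_def)
  have F_root: "fps_nth (poly P (F n)) i = 0" if "i \<le> n" for n i
    using that
  proof (induction n arbitrary: i)
    case 0
    then show ?case by (simp add: F_0 nth_0 assms(2))
  next
    case (Suc n)
    show ?case unfolding F_Suc step_def
      by (rule fps_newton_step) (use Suc in \<open>simp_all add: nth_0 F_nth_0 assms(3)\<close>)
  qed
  have F_stable: "fps_nth (F (n + k)) i = fps_nth (F n) i" if "i \<le> n" for n k i
    using that by (induction k) (simp_all add: F_Suc step_def fps_X_power_mult_right_nth)
  define f where "f = Abs_fps (\<lambda>n. fps_nth (F n) n)"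
  have f_nth: "fps_nth f i = fps_nth (F n) i" if "i \<le> n" for i n
    using F_stable[of i i "n - i"] that by (simp add: f_def)
  have "fps_nth (poly P f) n = 0" for n
    using poly_fps_nth_cong[of n f "F n" P, OF f_nth] F_root[of n n] by simp
  then have "poly P f = 0" by (intro fps_ext) simp
  moreover have "fps_nth f 0 = a" by (simp add: f_def F_nth_0)
  ultimately show ?thesis by blast
qed

interpretation fps_to_fls: inj_comm_ring_hom "fps_to_fls :: 'a::comm_ring_1 fps \<Rightarrow> 'a fls"
  by unfold_locales (simp_all add: fls_times_fps_to_fls)

lemma fps_poly_roots_lift:
  fixes P :: "'k::alg_closed_field fps poly"
  defines "p \<equiv> map_poly (\<lambda>f. fps_nth f 0) P" and "R \<equiv> {x. poly (map_poly fps_to_fls P) x = 0}"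
  assumes "degree p = degree P" "rsquarefree p"
  shows "bij_betw (\<lambda>x. fls_nth x 0) R {a. poly p a = 0}" "card R = degree P"
proof -
  let ?A = "{a. poly p a = 0}"
  have "\<exists>f. fps_nth f 0 = a \<and> poly P f = 0" if "a \<in> ?A" for a
    using fps_hensel[of P a] that assms(4) unfolding p_def rsquarefree_iff_pderiv by blast
  then obtain \<xi> where \<xi>_root: "\<And>a. a \<in> ?A \<Longrightarrow> fps_nth (\<xi> a) 0 = a \<and> poly P (\<xi> a) = 0" by metis
  define lift where "lift a = fps_to_fls (\<xi> a)" for a
  have nth_lift: "fls_nth (lift a) 0 = a" if "a \<in> ?A" for a
    using \<xi>_root[OF that] by (simp add: lift_def)
  have image_P: "map_poly fps_to_fls P \<noteq> 0" "degree (map_poly fps_to_fls P) = degree P"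
    using assms(4) by (auto simp: p_def rsquarefree_def)
  then have "finite R" "card R \<le> degree P"
    unfolding R_def using poly_roots_finite card_poly_roots_bound by metis+
  moreover have "lift ` ?A \<subseteq> R" using \<xi>_root by (auto simp: R_def lift_def)
  moreover have "card (lift ` ?A) = degree P"
    using card_image[OF inj_on_inverseI[of ?A "\<lambda>x. fls_nth x 0" lift]] nth_lift
    by (simp add: card_roots_rsquarefree assms(3,4))
  ultimately have image_lift: "lift ` ?A = R" by (metis card_seteq)
  then show "card R = degree P" using image_lift \<open>card (lift ` ?A) = degree P\<close> by simp
  show "bij_betw (\<lambda>x. fls_nth x 0) R ?A"
    by (rule bij_betwI[of _ _ _ lift]) (use nth_lift in \<open>auto simp flip: image_lift\<close>)
qed

text \<open>If \<open>z\<close> had a pole, \<open>u = 1 / z\<close> would be a power series without constant term, but the reflected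
  integral equation of \<open>z\<close>, satisfied by \<open>u\<close>, has constant term \<open>1\<close>.\<close>

lemma integral_over_fps_imp_fps:
  fixes z :: "'k::field fls"
  assumes "integral_over fps_to_fls z"
  shows "z \<in> range fps_to_fls"
proof (cases "fls_subdegree z \<ge> 0")
  case True
  then show ?thesis by (metis fls_regpart_to_fls_trivial rangeI)
next
  case False
  obtain p where monic_root: "lead_coeff p = 1" "poly (map_poly fps_to_fls p) z = 0"
    using assms unfolding integral_over_def by blast
  define u where "u = fls_regpart (inverse z)"
  have subdegree: "fls_subdegree (inverse z) > 0" using False by simp
  then have u_eq: "fps_to_fls u = inverse z" by (simp add: u_def)
  have u_0: "fps_nth u 0 = 0" using subdegree by (simp add: u_def)
  have "inverse z \<noteq> 0" using False by auto
  then have "poly (reflect_poly (map_poly fps_to_fls p)) (inverse z) = 0"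
    using monic_root(2) by (simp add: poly_reflect_poly_nz)
  moreover have "reflect_poly (map_poly fps_to_fls p) = map_poly fps_to_fls (reflect_poly p)"
    by (rule poly_eqI) (simp add: coeff_reflect_poly)
  ultimately have "poly (reflect_poly p) u = 0" by (simp flip: u_eq)
  then have "fps_nth (poly (reflect_poly p) u) 0 = 0" by simp
  moreover have "fps_nth (poly (reflect_poly p) u) 0 = fps_nth (coeff (reflect_poly p) 0) 0"
    using poly_fps_nth_cong[of 0 u 0 "reflect_poly p"] by (simp add: u_0 poly_0_coeff_0)
  ultimately show ?thesis using monic_root(1) by simp
qed

definition fls_map :: "('a::zero \<Rightarrow> 'b::zero) \<Rightarrow> 'a fls \<Rightarrow> 'b fls" where
  "fls_map g f = Abs_fls (\<lambda>n. g (fls_nth f n))"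

lemma fls_nth_fls_map: "g 0 = 0 \<Longrightarrow> fls_nth (fls_map g f) n = g (fls_nth f n)"
  unfolding fls_map_def by (rule nth_Abs_fls_lower_bound[of "fls_subdegree f"]) simp

lemma field_hom_fls_map:
  assumes "field_hom g"
  shows "field_hom (fls_map g)"
proof -
  interpret field_hom g by fact
  have subdegree: "fls_subdegree (fls_map g f) = fls_subdegree f" for f
  proof (cases "f = 0")
    case True
    have "fls_map g 0 = 0" by (rule fls_eqI) (simp add: fls_nth_fls_map)
    then show ?thesis using True by simp
  qed (rule fls_subdegree_eqI; simp add: fls_nth_fls_map)
  show ?thesis
  proof
    show "fls_map g (x * y) = fls_map g x * fls_map g y" for x y
      by (rule fls_eqI) (simp add: fls_nth_fls_map fls_times_nth(2) hom_sum hom_mult subdegree)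
  qed (rule fls_eqI; simp add: fls_nth_fls_map hom_add)+
qed

section \<open>Frobenius elements from a separable reduction\<close>

interpretation to_fract: inj_comm_ring_hom "to_fract :: 'r::idom \<Rightarrow> 'r fract"
  by unfold_locales simp_all

lemma ex_fract_hom_extension:
  fixes \<kappa> :: "'r::idom \<Rightarrow> 'f::field"
  assumes "inj_comm_ring_hom \<kappa>"
  shows "\<exists>\<iota>. field_hom \<iota> \<and> (\<forall>a. \<iota> (to_fract a) = \<kappa> a)"
proof -
  interpret inj_comm_ring_hom \<kappa> by fact
  define \<iota> where "\<iota> x = (THE y. \<exists>a b. b \<noteq> 0 \<and> x = Fract a b \<and> y = \<kappa> a / \<kappa> b)" for x
  have \<iota>_Fract: "\<iota> (Fract a b) = \<kappa> a / \<kappa> b" if "b \<noteq> 0" for a b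
    unfolding \<iota>_def
  proof (rule the_equality)
    fix y assume "\<exists>c d. d \<noteq> 0 \<and> Fract a b = Fract c d \<and> y = \<kappa> c / \<kappa> d"
    then obtain c d where Fract_eq: "d \<noteq> 0" "Fract a b = Fract c d" and y_eq: "y = \<kappa> c / \<kappa> d"
      by blast
    then have "\<kappa> (a * d) = \<kappa> (c * b)" using that by (simp add: eq_fract)
    then show "y = \<kappa> a / \<kappa> b" using Fract_eq(1) that by (simp add: y_eq frac_eq_eq hom_mult)
  qed (use that in blast)
  have "field_hom \<iota>"
  proof
    show "\<iota> 0 = 0" "\<iota> 1 = 1" by (simp_all add: Zero_fract_def One_fract_def \<iota>_Fract)
    fix x y :: "'r fract"
    obtain a b where x_eq: "x = Fract a b" "b \<noteq> 0" by (cases x)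
    obtain c d where y_eq: "y = Fract c d" "d \<noteq> 0" by (cases y)
    show "\<iota> (x + y) = \<iota> x + \<iota> y" using x_eq y_eq by (simp add: \<iota>_Fract hom_add hom_mult add_frac_eq)
    show "\<iota> (x * y) = \<iota> x * \<iota> y" using x_eq y_eq by (simp add: \<iota>_Fract hom_mult)
  qed
  then show ?thesis by (auto simp: to_fract_def \<iota>_Fract)
qed

locale separable_reduction = fq_alg_closed h + splitting_field emb "map_poly to_fract P"
  for h :: "'a::{field,finite} \<Rightarrow> 'k::alg_closed_field"
    and emb :: "'a poly fract \<Rightarrow> 'e::field" and P :: "'a poly poly" +
  fixes \<mu> :: 'a
  assumes degree_reduction: "degree (map_poly (\<lambda>a. h (poly a \<mu>)) P) = degree P"
    and rsquarefree_reduction: "rsquarefree (map_poly (\<lambda>a. h (poly a \<mu>)) P)"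
begin

definition expansion :: "'a poly \<Rightarrow> 'k fps" where
  "expansion a = fps_of_poly (map_poly h (a \<circ>\<^sub>p [:\<mu>, 1:]))"

sublocale expansion: inj_comm_ring_hom expansion
proof
  interpret map_h: map_poly_inj_idom_hom h ..
  show "expansion (a + b) = expansion a + expansion b" "expansion (a * b) = expansion a * expansion b" for a b
    by (simp_all add: expansion_def pcompose_add pcompose_mult map_h.hom_add map_h.hom_mult
        fps_of_poly_add fps_of_poly_mult)
  show "a = 0" if "expansion a = 0" for a
    using that by (simp add: expansion_def pcompose_eq_0_iff)
qed (simp_all add: expansion_def)

lemma expansion_nth_0: "fps_nth (expansion a) 0 = h (poly a \<mu>)"
proof -
  have "coeff (a \<circ>\<^sub>p [:\<mu>, 1:]) 0 = poly a \<mu>" by (simp add: poly_pcompose flip: poly_0_coeff_0)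
  then show ?thesis by (simp add: expansion_def)
qed

lemma expansion_nth_power_card: "fps_nth (expansion a) n ^ CARD('a) = fps_nth (expansion a) n"
  by (simp add: expansion_def hom_power_card)

lemma expansion_const: "expansion [:c:] = fps_const (h c)"
  by (simp add: expansion_def map_poly_pCons_hom fps_of_poly_const)

lemma map_expansion_reduction:
  "map_poly (\<lambda>f. fps_nth f 0) (map_poly expansion P) = map_poly (\<lambda>a. h (poly a \<mu>)) P"
  by (rule poly_eqI) (simp add: coeff_map_poly expansion_nth_0)

lemma roots_over_laurent_series:
  defines "R \<equiv> {x. poly (map_poly fps_to_fls (map_poly expansion P)) x = 0}"
  shows "bij_betw (\<lambda>x. fls_nth x 0) R {a. poly (map_poly (\<lambda>a. h (poly a \<mu>)) P) a = 0}" "card R = degree P"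
  using fps_poly_roots_lift[of "map_poly expansion P"] degree_reduction rsquarefree_reduction
  by (simp_all add: R_def map_expansion_reduction)

lemma ex_series_embedding: "\<exists>f. field_hom f \<and> (\<forall>a. f (emb (to_fract a)) = fps_to_fls (expansion a))"
proof -
  have "inj_comm_ring_hom (\<lambda>a. fps_to_fls (expansion a))"
    by unfold_locales (simp_all add: expansion.hom_add expansion.hom_mult fls_times_fps_to_fls)
  then obtain j where j_hom: "field_hom j" "\<And>a. j (to_fract a) = fps_to_fls (expansion a)"
    using ex_fract_hom_extension by blast
  interpret j: field_hom j by (rule j_hom(1))
  have "map_poly j (map_poly to_fract P) = map_poly fps_to_fls (map_poly expansion P)"
    by (rule poly_eqI) (simp add: coeff_map_poly j_hom(2))
  then have "card (roots_in j (map_poly to_fract P)) = degree (map_poly to_fract P)"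
    using roots_over_laurent_series(2) by (simp add: roots_in_def)
  then obtain f where "field_hom f" "\<And>x. f (emb x) = j x" using ex_embedding[OF j_hom(1)] by blast
  then show ?thesis by (intro exI[of _ f]) (simp add: j_hom(2))
qed

definition series :: "'e \<Rightarrow> 'k fls" where
  "series = (SOME f. field_hom f \<and> (\<forall>a. f (emb (to_fract a)) = fps_to_fls (expansion a)))"

lemma field_hom_series: "field_hom series"
  and series_emb: "series (emb (to_fract a)) = fps_to_fls (expansion a)"
  using someI_ex[OF ex_series_embedding] unfolding series_def by blast+

sublocale series: field_hom series
  by (rule field_hom_series)

lemma image_series_roots:
  "series ` roots_in emb (map_poly to_fract P) = {x. poly (map_poly fps_to_fls (map_poly expansion P)) x = 0}"
proof -
  have "map_poly (\<lambda>x. series (emb x)) (map_poly to_fract P) = map_poly fps_to_fls (map_poly expansion P)"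
    by (rule poly_eqI) (simp add: coeff_map_poly series_emb)
  then show ?thesis
    using image_roots[OF field_hom_series, of "\<lambda>x. series (emb x)"] by (simp add: roots_in_def)
qed

sublocale base: field_algebra "\<lambda>a. emb (to_fract a)"
  by unfold_locales (simp_all add: emb.hom_add emb.hom_mult)

lemma in_int_closure_iff: "z \<in> int_closure emb \<longleftrightarrow> integral_over (\<lambda>a. emb (to_fract a)) z"
  by (simp add: int_closure_def integral_over_def to_fract_def)

lemma gal_group_int_closure:
  assumes "s \<in> gal_group emb" "z \<in> int_closure emb"
  shows "s z \<in> int_closure emb"
proof -
  interpret s: field_hom s using assms(1) by (rule gal_group_field_hom)
  have "comm_ring_hom (\<lambda>a :: 'a poly. a)" by unfold_locales simp_all
  then have "integral_over (\<lambda>a. emb (to_fract a)) (s z)"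
    by (rule integral_over_hom[OF s.comm_ring_hom_axioms base.comm_ring_hom_axioms base.comm_ring_hom_axioms])
       (use assms in \<open>simp_all add: gal_group_def in_int_closure_iff\<close>)
  then show ?thesis by (simp add: in_int_closure_iff)
qed

lemma series_int_closure:
  assumes "z \<in> int_closure emb"
  shows "series z \<in> range fps_to_fls"
proof (rule integral_over_fps_imp_fps)
  show "integral_over fps_to_fls (series z)"
    by (rule integral_over_hom[OF series.comm_ring_hom_axioms base.comm_ring_hom_axioms
          fps_to_fls.comm_ring_hom_axioms expansion.comm_ring_hom_axioms])
       (use assms in \<open>simp_all add: series_emb in_int_closure_iff\<close>)
qed

definition residue :: "'e \<Rightarrow> 'k" where
  "residue z = fls_nth (series z) 0"

lemma residue_add: "residue (x + y) = residue x + residue y"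
  and residue_diff: "residue (x - y) = residue x - residue y"
  and residue_uminus: "residue (- x) = - residue x"
  and residue_0: "residue 0 = 0" and residue_1: "residue 1 = 1"
  by (simp_all add: residue_def series.hom_add series.hom_minus series.hom_uminus)

lemma residue_mult:
  assumes "x \<in> int_closure emb" "y \<in> int_closure emb"
  shows "residue (x * y) = residue x * residue y"
proof -
  obtain f g where "series x = fps_to_fls f" "series y = fps_to_fls g"
    using assms[THEN series_int_closure] by auto
  then show ?thesis by (simp add: residue_def series.hom_mult flip: fls_times_fps_to_fls)
qed

lemma residue_power:
  assumes "x \<in> int_closure emb"
  shows "residue (x ^ n) = residue x ^ n"
proof (induction n)
  case (Suc n)
  have "x ^ n \<in> int_closure emb"
    using assms by (simp add: in_int_closure_iff base.integral_over_power)
  then show ?case using Suc assms by (simp add: residue_mult)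
qed (simp add: residue_1)

lemma residue_base: "residue (emb (to_fract a)) = h (poly a \<mu>)"
  by (simp add: residue_def series_emb expansion_nth_0)

lemma residue_scal: "residue (scal emb c x) = h c * residue x"
  by (simp add: residue_def scal_def const_ff_def series.hom_mult series_emb expansion_const flip: to_fract_def)

lemma bij_betw_residue_roots:
  "bij_betw residue (roots_in emb (map_poly to_fract P)) {a. poly (map_poly (\<lambda>a. h (poly a \<mu>)) P) a = 0}"
proof -
  have "bij_betw series (roots_in emb (map_poly to_fract P))
      {x. poly (map_poly fps_to_fls (map_poly expansion P)) x = 0}"
    using inj_on_subset[OF series.inj_f] image_series_roots by (intro bij_betw_imageI) auto
  from bij_betw_trans[OF this roots_over_laurent_series(1)] show ?thesis
    by (simp add: residue_def[abs_def] comp_def)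
qed

definition residue_ideal :: "'e set" where
  "residue_ideal = {z \<in> int_closure emb. residue z = 0}"

lemma prime_residue_ideal: "prime_ideal_in (int_closure emb) residue_ideal"
  unfolding prime_ideal_in_def
proof (intro conjI)
  have "1 \<in> int_closure emb" "1 \<notin> residue_ideal"
    by (simp_all add: in_int_closure_iff base.integral_over_1 residue_ideal_def residue_1)
  then show "residue_ideal \<noteq> int_closure emb" by auto
qed (auto simp: residue_ideal_def residue_0 residue_add residue_uminus residue_mult in_int_closure_iff
    intro: base.integral_over_0 base.integral_over_add base.integral_over_uminus base.integral_over_mult)

lemma residue_ideal_lies_over: "lies_over emb residue_ideal \<mu>"
proof -
  have "emb (to_fract a) \<in> residue_ideal \<longleftrightarrow> [:- \<mu>, 1:] dvd a" for a
    using base.integral_over_base[of a]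
    by (simp add: residue_ideal_def in_int_closure_iff residue_base poly_eq_0_iff_dvd)
  then show ?thesis by (simp add: lies_over_def to_fract_def)
qed

lemma ex_gal_group_residue_power_card: "\<exists>\<sigma>\<in>gal_group emb. \<forall>z. residue (\<sigma> z) = residue z ^ CARD('a)"
proof -
  define \<phi> :: "'k fls \<Rightarrow> 'k fls" where "\<phi> = fls_map (\<lambda>x. x ^ CARD('a))"
  have "field_hom (\<lambda>x :: 'k. x ^ CARD('a))"
    by unfold_locales (simp_all add: frob.hom_add power_mult_distrib)
  then have \<phi>_hom: "field_hom \<phi>" unfolding \<phi>_def by (rule field_hom_fls_map)
  have \<phi>_nth: "fls_nth (\<phi> f) n = fls_nth f n ^ CARD('a)" for f n
    by (simp add: \<phi>_def fls_nth_fls_map)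
  interpret \<phi>: field_hom \<phi> by (rule \<phi>_hom)
  have "\<phi> (series (emb (to_fract a))) = series (emb (to_fract a))" for a
    by (rule fls_eqI) (simp add: \<phi>_nth series_emb expansion_nth_power_card)
  then have "\<phi> (series (emb x)) = series (emb x)" for x
    by (cases x) (simp add: Fract_conv_to_fract emb.hom_div series.hom_div \<phi>.hom_div)
  then obtain \<sigma> where "\<sigma> \<in> gal_group emb" "\<And>z. series (\<sigma> z) = \<phi> (series z)"
    using ex_gal_group_lift[OF field_hom_series \<phi>_hom] by blast
  then show ?thesis by (intro bexI[of _ \<sigma>]) (simp_all add: residue_def \<phi>_nth)
qed

lemma frobenius_at_residue_ideal:
  assumes \<sigma>_gal: "\<sigma> \<in> gal_group emb" and residue_\<sigma>: "\<And>z. residue (\<sigma> z) = residue z ^ CARD('a)"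
  shows "frobenius_at emb residue_ideal \<sigma>"
  unfolding frobenius_at_def
proof (intro conjI ballI)
  have "bij \<sigma>" using \<sigma>_gal by (simp add: gal_group_def)
  have "z \<in> \<sigma> ` residue_ideal" if z_in: "z \<in> residue_ideal" for z
  proof -
    have \<sigma>_inv: "\<sigma> (inv \<sigma> z) = z" using \<open>bij \<sigma>\<close> by (simp add: bij_is_surj surj_f_inv_f)
    then have "residue (inv \<sigma> z) = 0"
      using residue_\<sigma>[of "inv \<sigma> z"] z_in by (simp add: residue_ideal_def)
    moreover have "inv \<sigma> z \<in> int_closure emb"
      using gal_group_int_closure[OF gal_group_inv[OF \<sigma>_gal]] z_in by (simp add: residue_ideal_def)
    ultimately show ?thesis
      by (intro image_eqI[of _ _ "inv \<sigma> z"]) (simp_all add: residue_ideal_def \<sigma>_inv)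
  qed
  then show "\<sigma> ` residue_ideal = residue_ideal"
    using gal_group_int_closure[OF \<sigma>_gal] by (auto simp: residue_ideal_def residue_\<sigma>)
  fix z assume z_in: "z \<in> int_closure emb"
  then have "\<sigma> z - z ^ CARD('a) \<in> int_closure emb"
    using gal_group_int_closure[OF \<sigma>_gal]
    by (simp add: in_int_closure_iff base.integral_over_diff base.integral_over_power)
  then show "\<sigma> z - z ^ CARD('a) \<in> residue_ideal"
    using z_in by (simp add: residue_ideal_def residue_diff residue_\<sigma> residue_power)
qed (rule \<sigma>_gal)

end

section \<open>The invariant alternating form\<close>

lemma sum_symmetric_split:
  fixes F :: "nat \<Rightarrow> 'b::comm_monoid_add"
  shows "(\<Sum>k\<le>2 * m. F k) = F m + (\<Sum>i\<in>{1..m}. F (m + i) + F (m - i))"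
proof -
  have "(\<Sum>k\<in>{m - n..m + n}. F k) = F m + (\<Sum>i\<in>{1..n}. F (m + i) + F (m - i))" if "n \<le> m" for n
    using that
  proof (induction n)
    case (Suc n)
    have "{m - Suc n..m + Suc n} = insert (m - Suc n) (insert (m + Suc n) {m - n..m + n})"
      using Suc.prems by auto
    moreover have "m - Suc n \<notin> {m - n..m + n}" "m + Suc n \<notin> {m - n..m + n}" "m - Suc n \<noteq> m + Suc n"
      using Suc.prems by auto
    ultimately show ?case using Suc by (simp add: ac_simps)
  qed simp
  from this[of m] show ?thesis by (simp add: mult_2 atLeast0AtMost)
qed

context fq_algebra
begin

definition moore_minor :: "'b \<Rightarrow> 'b \<Rightarrow> nat \<Rightarrow> nat \<Rightarrow> 'b" where
  "moore_minor x y a b = x ^ (CARD('a) ^ a) * y ^ (CARD('a) ^ b) - x ^ (CARD('a) ^ b) * y ^ (CARD('a) ^ a)"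

definition palindrome_form :: "'a poly \<Rightarrow> nat \<Rightarrow> 'b \<Rightarrow> 'b \<Rightarrow> 'b" where
  "palindrome_form M m x y = (\<Sum>i\<in>{1..m}. \<Sum>j<i. h (coeff M (m + i)) * moore_minor x y (m - i + j) (m + j))"

lemma moore_minor_power_card: "moore_minor x y a b ^ CARD('a) = moore_minor x y (Suc a) (Suc b)"
  by (simp add: moore_minor_def frob.hom_minus power_mult_distrib mult.commute[of "CARD('a)"] flip: power_mult)

lemma palindrome_form_skew: "palindrome_form M m x y = - palindrome_form M m y x"
  by (simp add: palindrome_form_def moore_minor_def algebra_simps flip: sum_negf)

lemma palindrome_form_self: "palindrome_form M m x x = 0"
  by (simp add: palindrome_form_def moore_minor_def)

lemma palindrome_form_add_left:
  "palindrome_form M m (x + x') y = palindrome_form M m x y + palindrome_form M m x' y"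
  by (simp add: palindrome_form_def moore_minor_def frob_pow.hom_add algebra_simps sum.distrib sum_subtractf)

lemma palindrome_form_add_right:
  "palindrome_form M m x (y + y') = palindrome_form M m x y + palindrome_form M m x y'"
  by (subst (1 2 3) palindrome_form_skew) (simp add: palindrome_form_add_left)

lemma palindrome_form_scale_left: "palindrome_form M m (h c * x) y = h c * palindrome_form M m x y"
  by (simp add: palindrome_form_def moore_minor_def power_mult_distrib hom_power_card_power
      sum_distrib_left algebra_simps)

lemma palindrome_form_scale_right: "palindrome_form M m x (h c * y) = h c * palindrome_form M m x y"
  by (subst (1 2) palindrome_form_skew) (simp add: palindrome_form_scale_left)

lemma palindrome_form_hom:
  assumes "comm_ring_hom s" "\<And>c. s (h c) = h c"
  shows "s (palindrome_form M m x y) = palindrome_form M m (s x) (s y)"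
proof -
  interpret s: comm_ring_hom s by fact
  show ?thesis
    by (simp add: palindrome_form_def moore_minor_def s.hom_sum s.hom_mult s.hom_minus s.hom_power assms(2))
qed

lemma poly_q_associate_palindromic:
  assumes "degree M = 2 * m" and palindromic: "\<And>i. i \<le> 2 * m \<Longrightarrow> coeff M i = coeff M (2 * m - i)"
  shows "poly (q_associate h M) z = h (coeff M m) * z ^ (CARD('a) ^ m) +
    (\<Sum>i\<in>{1..m}. h (coeff M (m + i)) * (z ^ (CARD('a) ^ (m + i)) + z ^ (CARD('a) ^ (m - i))))"
proof -
  have "coeff M (m - i) = coeff M (m + i)" if "i \<in> {1..m}" for i
  proof -
    have "2 * m - (m - i) = m + i" "m - i \<le> 2 * m" using that by auto
    then show ?thesis using palindromic[of "m - i"] by simp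
  qed
  moreover have "poly (q_associate h M) z = h (coeff M m) * z ^ (CARD('a) ^ m) +
      (\<Sum>i\<in>{1..m}. h (coeff M (m + i)) * z ^ (CARD('a) ^ (m + i))
        + h (coeff M (m - i)) * z ^ (CARD('a) ^ (m - i)))"
    unfolding poly_q_associate assms(1) by (rule sum_symmetric_split)
  ultimately show ?thesis by (simp add: distrib_left)
qed

lemma palindrome_form_power_card_diff:
  "palindrome_form M m x y ^ CARD('a) - palindrome_form M m x y =
   - (\<Sum>i\<in>{1..m}. h (coeff M (m + i)) * (moore_minor x y (m + i) m + moore_minor x y (m - i) m))"
proof -
  let ?minor = "\<lambda>i j. moore_minor x y (m - i + j) (m + j)"
  have telescope: "(\<Sum>j<i. ?minor i (Suc j) - ?minor i j)
      = - (moore_minor x y (m + i) m + moore_minor x y (m - i) m)" if "i \<in> {1..m}" for i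
    using sum_lessThan_telescope[of "?minor i" i] that by (simp add: moore_minor_def algebra_simps)
  have "palindrome_form M m x y ^ CARD('a) - palindrome_form M m x y =
      (\<Sum>i\<in>{1..m}. h (coeff M (m + i)) * (\<Sum>j<i. ?minor i (Suc j) - ?minor i j))"
    by (simp add: palindrome_form_def frob.hom_sum power_mult_distrib hom_power_card moore_minor_power_card
        sum_distrib_left sum_subtractf right_diff_distrib)
  also have "\<dots> = (\<Sum>i\<in>{1..m}.
      - (h (coeff M (m + i)) * (moore_minor x y (m + i) m + moore_minor x y (m - i) m)))"
    by (rule sum.cong) (simp_all only: telescope mult_minus_right)
  finally show ?thesis by (simp only: sum_negf)
qed

lemma palindrome_form_power_card:
  assumes "degree M = 2 * m" "\<And>i. i \<le> 2 * m \<Longrightarrow> coeff M i = coeff M (2 * m - i)"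
    and x_root: "poly (deformed_associate h \<tau> m M) x = 0"
    and y_root: "poly (deformed_associate h \<tau> m M) y = 0"
  shows "palindrome_form M m x y ^ CARD('a) = palindrome_form M m x y"
proof -
  let ?L = "\<lambda>z. poly (deformed_associate h \<tau> m M) z" and ?e = "CARD('a) ^ m"
  have "0 = ?L x * y ^ ?e - ?L y * x ^ ?e" using x_root y_root by simp
  also have "\<dots> = (\<Sum>i\<in>{1..m}.
      h (coeff M (m + i)) * (moore_minor x y (m + i) m + moore_minor x y (m - i) m))"
    by (simp add: deformed_associate_def poly_q_associate_palindromic[OF assms(1,2)] poly_monom moore_minor_def
        algebra_simps sum_distrib_left sum_distrib_right sum.distrib sum_subtractf)
  finally show ?thesis using palindrome_form_power_card_diff[of M m x y] by simp
qed

end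

text \<open>As a polynomial in \<open>y\<close>, the form has degree below \<open>q ^ (2 m)\<close> and linear coefficient \<open>- x ^ (q ^ m)\<close>.\<close>

lemma (in fq_hom) palindrome_form_nondegenerate:
  assumes m_pos: "1 \<le> m" and lead: "coeff M (2 * m) = 1" and card: "CARD('a) ^ (2 * m) \<le> card A"
    and vanish: "\<And>y. y \<in> A \<Longrightarrow> palindrome_form M m x y = 0"
  shows "x = 0"
proof -
  define w where "w i j = monom (x ^ (CARD('a) ^ (m - i + j))) (CARD('a) ^ (m + j))
    - monom (x ^ (CARD('a) ^ (m + j))) (CARD('a) ^ (m - i + j))" for i j
  define W where "W = (\<Sum>i\<in>{1..m}. \<Sum>j<i. smult (h (coeff M (m + i))) (w i j))"
  have "poly W y = palindrome_form M m x y" for y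
    by (simp add: W_def w_def palindrome_form_def moore_minor_def poly_sum poly_monom)
  moreover have "degree (w i j) \<le> CARD('a) ^ (2 * m - 1)" if "i \<in> {1..m}" "j < i" for i j
    unfolding w_def using that
    by (intro degree_diff_le order.trans[OF degree_monom_le]) (auto simp: card_field_power_le_iff)
  then have "degree W \<le> CARD('a) ^ (2 * m - 1)"
    unfolding W_def by (intro degree_sum_le) (auto intro: order.trans[OF degree_smult_le])
  then have "degree W < CARD('a) ^ (2 * m)"
    by (rule le_less_trans) (use m_pos in \<open>simp add: card_field_power_less_iff\<close>)
  ultimately have "W = 0" using vanish card by (intro poly_eqI_degree[of A]) simp_all
  moreover have "coeff W 1 = - (x ^ (CARD('a) ^ m))"
  proof -
    have coeff_w: "coeff (smult (h (coeff M (m + i))) (w i j)) 1 =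
        (if i = m \<and> j = 0 then - (x ^ (CARD('a) ^ m)) else 0)"
      if "i \<in> {1..m}" for i j
      using that lead card_field_power_eq_iff[where 'a='a, of _ 0] by (auto simp: w_def mult_2)
    have "coeff W 1 = (\<Sum>i\<in>{1..m}. \<Sum>j<i. if i = m \<and> j = 0 then - (x ^ (CARD('a) ^ m)) else 0)"
      unfolding W_def coeff_sum by (intro sum.cong refl coeff_w)
    also have "\<dots> = (\<Sum>i\<in>{1..m}. if i = m then - (x ^ (CARD('a) ^ m)) else 0)"
      by (intro sum.cong refl) (simp add: m_pos)
    finally show ?thesis using m_pos by simp
  qed
  ultimately show ?thesis by simp
qed

section \<open>The transvection\<close>

lemma (in fq_hom) power_card_power_diff_in_range:
  assumes "M dvd [:-1, 1:] * (monom 1 n - 1)" "poly (q_associate h M) a = 0"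
  shows "a ^ (CARD('a) ^ n) - a \<in> range h"
proof -
  have "poly (q_associate h ([:-1, 1:] * (monom 1 n - 1))) a = 0"
    using assms by (rule poly_q_associate_eq_0_if_dvd)
  then have "poly (q_associate h [:-1, 1:]) (a ^ (CARD('a) ^ n) - a) = 0"
    by (simp only: poly_q_associate_mult poly_q_associate_X_power_minus_1)
  then show ?thesis
    by (intro power_card_eq_imp_in_range) (simp add: poly_q_associate_pCons hom_uminus algebra_simps)
qed

lemma self_reciprocal_coeff_eq:
  assumes "self_reciprocal g" "coeff g 0 = 1" "degree g = n" "i \<le> n"
  shows "coeff g i = coeff g (n - i)"
proof -
  have "g = reflect_poly g" using assms(1,2) by (simp add: self_reciprocal_def)
  then have "coeff g i = coeff (reflect_poly g) i" by (rule arg_cong)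
  then show ?thesis using assms(3,4) by (simp add: coeff_reflect_poly)
qed

locale palindromic_deformation = fq_alg_closed h for h :: "'a::{field,finite} \<Rightarrow> 'k::alg_closed_field" +
  fixes emb :: "'a poly fract \<Rightarrow> 'e::field" and M :: "'a poly" and m :: nat
  assumes m_pos: "1 \<le> m" and degree_M: "degree M = 2 * m" and coeff_M_0: "coeff M 0 = 1"
    and palindromic: "\<And>i. i \<le> 2 * m \<Longrightarrow> coeff M i = coeff M (2 * m - i)"
    and splitting_L: "is_splitting_field emb (L_poly m M)"
begin

definition integral_L :: "'a poly poly" where
  "integral_L = deformed_associate (\<lambda>c. [:c:]) [:0, 1:] m M"

lemma L_poly_eq: "L_poly m M = map_poly to_fract integral_L"
  by (simp add: L_poly_eq_deformed_associate integral_L_def to_fract.map_poly_deformed_associate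
      const_ff_def[abs_def] tvar_def to_fract_def)

lemma reduction_integral_L: "map_poly (\<lambda>a. h (poly a 0)) integral_L = q_associate h M"
proof -
  interpret red: comm_ring_hom "\<lambda>a. h (poly a 0)"
    by unfold_locales (simp_all add: hom_add hom_mult)
  show ?thesis
    unfolding integral_L_def red.map_poly_deformed_associate by (simp add: deformed_associate_def)
qed

sublocale separable_reduction h emb integral_L 0
proof unfold_locales
  show "is_splitting_field emb (map_poly to_fract integral_L)"
    using splitting_L by (simp add: L_poly_eq)
  have "M \<noteq> 0" using coeff_M_0 by auto
  then have "degree (q_associate h M) = CARD('a) ^ (2 * m)"
    by (simp add: degree_q_associate degree_M)
  moreover have "degree integral_L \<le> CARD('a) ^ (2 * m)"
    unfolding integral_L_def using degree_deformed_associate_le[of m M] degree_M by simp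
  moreover have "degree (q_associate h M) \<le> degree integral_L"
    using degree_map_poly_le by (metis reduction_integral_L)
  ultimately show "degree (map_poly (\<lambda>a. h (poly a 0)) integral_L) = degree integral_L"
    by (simp add: reduction_integral_L)
  show "rsquarefree (map_poly (\<lambda>a. h (poly a 0)) integral_L)"
    unfolding reduction_integral_L using coeff_M_0 by (intro rsquarefree_q_associate) simp
qed

abbreviation V :: "'e set" where "V \<equiv> roots_in emb (L_poly m M)"

definition scalar :: "'a \<Rightarrow> 'e" where "scalar c = emb (const_ff c)"

sublocale E: fq_hom scalar
  by unfold_locales
     (simp_all add: scalar_def const_ff_def Zero_fract_def[symmetric] One_fract_def[symmetric] one_pCons[symmetric]
       mult.commute emb.hom_add[symmetric] emb.hom_mult[symmetric])

lemma in_V_iff: "x \<in> V \<longleftrightarrow> poly (deformed_associate scalar (emb tvar) m M) x = 0"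
  by (simp add: roots_in_def L_poly_eq_deformed_associate emb.map_poly_deformed_associate scalar_def[abs_def])

lemma scal_eq: "scal emb c x = scalar c * x"
  by (simp add: scal_def scalar_def)

lemma V_add: "x \<in> V \<Longrightarrow> y \<in> V \<Longrightarrow> x + y \<in> V"
  by (simp add: in_V_iff E.poly_deformed_associate_add)

lemma V_scal: "x \<in> V \<Longrightarrow> scalar c * x \<in> V"
  by (simp add: in_V_iff E.poly_deformed_associate_scale)

lemma V_diff: "x \<in> V \<Longrightarrow> y \<in> V \<Longrightarrow> x - y \<in> V"
  using V_add[of x "scalar (-1) * y"] V_scal[of y "-1"] by (simp add: E.hom_uminus)

lemma bij_betw_residue_V: "bij_betw residue V {a. poly (q_associate h M) a = 0}"
  using bij_betw_residue_roots by (simp add: L_poly_eq reduction_integral_L)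

lemma residue_inj_on_V: "x \<in> V \<Longrightarrow> y \<in> V \<Longrightarrow> residue x = residue y \<Longrightarrow> x = y"
  using bij_betw_residue_V by (auto simp: bij_betw_def inj_on_def)

lemma ex_residue_lift:
  assumes "poly (q_associate h M) a = 0"
  shows "\<exists>x\<in>V. residue x = a"
  using bij_betw_residue_V assms unfolding bij_betw_def by (metis (mono_tags) imageE mem_Collect_eq)

lemma q_associate_residue_V: "x \<in> V \<Longrightarrow> poly (q_associate h M) (residue x) = 0"
  using bij_betw_residue_V by (auto simp: bij_betw_def)

lemma card_V: "card V = CARD('a) ^ (2 * m)"
  using bij_betw_same_card[OF bij_betw_residue_V] coeff_M_0 by (simp add: card_roots_q_associate degree_M)

lemma gal_group_image_V: "s \<in> gal_group emb \<Longrightarrow> s ` V = V"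
  unfolding L_poly_eq by (rule gal_group_image_roots)

definition root_form :: "'e \<Rightarrow> 'e \<Rightarrow> 'a" where
  "root_form x y = inv scalar (E.palindrome_form M m x y)"

lemma scalar_root_form: "x \<in> V \<Longrightarrow> y \<in> V \<Longrightarrow> scalar (root_form x y) = E.palindrome_form M m x y"
  unfolding root_form_def in_V_iff
  by (intro f_inv_into_f E.power_card_eq_imp_in_range E.palindrome_form_power_card degree_M palindromic)

lemma inv_symplectic_form_root_form: "inv_symplectic_form emb V (gal_group emb) root_form"
  unfolding inv_symplectic_form_def
proof (intro conjI ballI allI impI)
  fix x y z assume in_V: "x \<in> V" "y \<in> V" "z \<in> V"
  show "root_form (x + y) z = root_form x z + root_form y z"
    by (rule E.injectivity) (simp only: scalar_root_form in_V V_add E.hom_add E.palindrome_form_add_left)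
  show "root_form z (x + y) = root_form z x + root_form z y"
    by (rule E.injectivity) (simp only: scalar_root_form in_V V_add E.hom_add E.palindrome_form_add_right)
next
  fix c x y assume in_V: "x \<in> V" "y \<in> V"
  show "root_form (scal emb c x) y = c * root_form x y"
    by (rule E.injectivity)
       (simp only: scalar_root_form in_V V_scal E.hom_mult scal_eq[of c x] E.palindrome_form_scale_left)
  show "root_form x (scal emb c y) = c * root_form x y"
    by (rule E.injectivity)
       (simp only: scalar_root_form in_V V_scal E.hom_mult scal_eq[of c y] E.palindrome_form_scale_right)
next
  fix x assume "x \<in> V"
  then have "scalar (root_form x x) = 0" by (simp add: scalar_root_form E.palindrome_form_self)
  then show "root_form x x = 0" by (rule E.hom_0)
next
  fix x assume x_in_V: "x \<in> V" and orthogonal: "\<forall>y\<in>V. root_form x y = 0"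
  have "coeff M (2 * m) = 1" using palindromic[of 0] coeff_M_0 by simp
  moreover have "E.palindrome_form M m x y = 0" if "y \<in> V" for y
    using scalar_root_form[OF x_in_V that] orthogonal that by simp
  ultimately show "x = 0"
    using E.palindrome_form_nondegenerate[of m M V x] m_pos card_V by simp
next
  fix s x y assume s_gal: "s \<in> gal_group emb" and in_V: "x \<in> V" "y \<in> V"
  interpret s: field_hom s using s_gal by (rule gal_group_field_hom)
  have fixed: "s (scalar c) = scalar c" for c using s_gal by (simp add: gal_group_def scalar_def)
  have "s x \<in> V" "s y \<in> V" using gal_group_image_V[OF s_gal] in_V by blast+
  then have "scalar (root_form (s x) (s y)) = E.palindrome_form M m (s x) (s y)"
    by (rule scalar_root_form)
  also have "\<dots> = s (scalar (root_form x y))"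
    by (simp only: scalar_root_form in_V E.palindrome_form_hom[OF s.comm_ring_hom_axioms fixed])
  finally show "root_form (s x) (s y) = root_form x y" by (intro E.injectivity) (simp only: fixed)
qed

context
  fixes \<sigma> :: "'e \<Rightarrow> 'e"
  assumes \<sigma>_gal: "\<sigma> \<in> gal_group emb" and residue_\<sigma>: "\<And>z. residue (\<sigma> z) = residue z ^ CARD('a)"
begin

lemma residue_funpow: "residue ((\<sigma> ^^ n) x) = residue x ^ (CARD('a) ^ n)"
  by (induction n) (simp_all add: residue_\<sigma> mult.commute[of "CARD('a)"] flip: power_mult)

lemma funpow_in_V: "x \<in> V \<Longrightarrow> (\<sigma> ^^ n) x \<in> V"
  using gal_group_image_V[OF gal_group_funpow[OF \<sigma>_gal]] by blast

lemma funpow_diff_in_line: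
  assumes "M dvd [:-1, 1:] * (monom 1 n - 1)" "x \<in> V" "v \<in> V" "residue v = 1"
  shows "\<exists>c. (\<sigma> ^^ n) x - x = scal emb c v"
proof -
  obtain c where "residue ((\<sigma> ^^ n) x - x) = h c"
    using power_card_power_diff_in_range[OF assms(1) q_associate_residue_V[OF assms(2)]]
    by (auto simp: residue_diff residue_funpow)
  then have "residue ((\<sigma> ^^ n) x - x) = residue (scal emb c v)" by (simp add: residue_scal assms(4))
  then have "(\<sigma> ^^ n) x - x = scal emb c v"
    by (rule residue_inj_on_V[rotated 2]) (simp_all add: scal_eq V_scal V_diff funpow_in_V assms)
  then show ?thesis by blast
qed

lemma funpow_fixes_line:
  assumes "v \<in> V" "residue v = 1"
  shows "(\<sigma> ^^ n) (scal emb c v) = scal emb c v"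
proof (rule residue_inj_on_V)
  show "scal emb c v \<in> V" "(\<sigma> ^^ n) (scal emb c v) \<in> V"
    by (simp_all add: scal_eq V_scal funpow_in_V assms)
  show "residue ((\<sigma> ^^ n) (scal emb c v)) = residue (scal emb c v)"
    by (simp add: residue_funpow residue_scal assms hom_power_card_power)
qed

lemma ex_funpow_moved:
  assumes "\<not> M dvd monom 1 n - 1"
  shows "\<exists>x\<in>V. (\<sigma> ^^ n) x \<noteq> x"
proof -
  obtain a where moved: "poly (q_associate h M) a = 0" "a ^ (CARD('a) ^ n) \<noteq> a"
    using q_associate_roots_subset_iff_dvd[of M "monom 1 n - 1"] assms coeff_M_0
    by (auto simp: poly_q_associate_X_power_minus_1)
  obtain x where "x \<in> V" "residue x = a" using ex_residue_lift[OF moved(1)] by blast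
  then show ?thesis using moved(2) residue_funpow[of n x] by (intro bexI[of _ x]) auto
qed

lemma symplectic_transvection_funpow:
  assumes exponent: "M dvd [:-1, 1:] * (monom 1 n - 1)" "\<not> M dvd monom 1 n - 1" and "poly M 1 = 0"
  shows "symplectic_transvection emb V root_form (\<sigma> ^^ n)"
proof -
  have funpow_gal: "\<sigma> ^^ n \<in> gal_group emb" using \<sigma>_gal by (rule gal_group_funpow)
  have "poly (q_associate h M) 1 = 0" by (simp add: poly_q_associate_at_1 assms(3))
  then obtain v where v_residue: "v \<in> V" "residue v = 1" using ex_residue_lift by blast
  show ?thesis unfolding symplectic_transvection_def
  proof (intro conjI ballI)
    show "(\<sigma> ^^ n) ` V = V" using funpow_gal by (rule gal_group_image_V)
    show "root_form ((\<sigma> ^^ n) x) ((\<sigma> ^^ n) y) = root_form x y" if "x \<in> V" "y \<in> V" for x y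
      using inv_symplectic_form_root_form funpow_gal that unfolding inv_symplectic_form_def by blast
    show "\<exists>x\<in>V. (\<sigma> ^^ n) x \<noteq> x" using exponent(2) by (rule ex_funpow_moved)
    show "(\<sigma> ^^ n) ((\<sigma> ^^ n) x - x) - ((\<sigma> ^^ n) x - x) = 0" if "x \<in> V" for x
      using funpow_diff_in_line[OF exponent(1) that v_residue] funpow_fixes_line[OF v_residue] by auto
    have "v \<noteq> 0" using v_residue(2) residue_0 by auto
    then show "\<exists>v\<in>V. v \<noteq> 0 \<and> (\<forall>x\<in>V. \<exists>c. (\<sigma> ^^ n) x - x = scal emb c v)"
      using v_residue funpow_diff_in_line[OF exponent(1)] by blast
  qed
qed

end

end

theorem theorem3p5:
  fixes M :: "'a::{field,finite} poly"
    and m :: nat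
    and emb :: "'a poly fract \<Rightarrow> 'e::field"
  assumes "m \<ge> 1"
    and "degree M = 2 * m"
    and "self_reciprocal M"
    and "coeff M 0 = 1"
    and "order 1 M = 2"
    and "\<not> [:-1, 1:] dvd (M div [:-1, 1:] ^ 2)"
    and "\<not> [:1, 1:] dvd (M div [:-1, 1:] ^ 2)"
    and "squarefree (M div [:-1, 1:] ^ 2)"
    and "is_splitting_field emb (L_poly m M)"
  shows "\<exists>B. inv_symplectic_form emb (roots_in emb (L_poly m M)) (gal_group emb) B \<and>
           (\<exists>\<mu> :: 'a. \<exists>J \<sigma> k.
              prime_ideal_in (int_closure emb) J \<and> lies_over emb J \<mu> \<and>
              frobenius_at emb J \<sigma> \<and>
              symplectic_transvection emb (roots_in emb (L_poly m M)) B (\<sigma> ^^ k))"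
proof -
  interpret palindromic_deformation "to_ac :: 'a \<Rightarrow> 'a alg_closure" emb M m
    by unfold_locales
       (fact to_ac_0 to_ac_add to_ac_1 to_ac_mult assms self_reciprocal_coeff_eq[OF assms(3,4,2)])+
  obtain \<sigma> where frobenius: "\<sigma> \<in> gal_group emb" "\<And>z. residue (\<sigma> z) = residue z ^ CARD('a)"
    using ex_gal_group_residue_power_card by blast
  obtain n where exponent: "M dvd [:-1, 1:] * (monom 1 n - 1)" "\<not> M dvd monom 1 n - 1"
    using ex_transvection_exponent[of M] assms(4,5,8) by auto
  have "poly M 1 = 0" using assms(5) by (simp add: order_root)
  then have "symplectic_transvection emb V root_form (\<sigma> ^^ n)"
    using symplectic_transvection_funpow[OF frobenius] exponent by blast
  then show ?thesis
    using inv_symplectic_form_root_form prime_residue_ideal residue_ideal_lies_over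
      frobenius_at_residue_ideal[OF frobenius] by blast
qed

end
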